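(* Let $I$ be a general $(r,d)$-symmetric ideal of $R$ and let $M$ be a maximal $r$-generated submodule of $R_d$. Then $\dim_k I_d=\dim_k M$. In particular, $I_d$ is a maximal $r$-generated submodule of $R_d$. (That is, there is a nonempty Zariski open set $U\subseteq\operatorname{Gr}_k(r,R_d)$ such that these statements hold for $I=(L)_{\mathfrak{S}_n}$ for every $L\in U$.)
   Context: $k$ is an infinite field with $\operatorname{char}(k)=0$ or $\operatorname{char}(k)>n$; $R=k[x_1,\dots,x_n]$ with the standard grading, and $R_d$, $I_d$ denote degree-$d$ components. The symmetric group $\mathfrak{S}_n$ acts on $R$ by $\sigma\cdot f(x_1,\dots,x_n)=f(x_{\sigma(1)},\dots,x_{\sigma(n)})$. A $k\mathfrak{S}_n$-module is $r$-generated if it can be generated by $r$ elements as a $k\mathfrak{S}_n$-module. A maximal $r$-generated submodule of $R_d$ is an $r$-generated $k\mathfrak{S}_n$-submodule of $R_d$ not contained in any other $r$-generated $k\mathfrak{S}_n$-submodule of $R_d$. $\operatorname{Gr}_k(r,R_d)$ is the Grassmannian of $r$-dimensional linear subspaces of $R_d$ (here $1\le r\le\dim_k R_d$), with the Zariski topology coming from the Plücker embedding. For $L\in\operatorname{Gr}_k(r,R_d)$, $(L)_{\mathfrak{S}_n}$ is the ideal of $R$ generated by all $\sigma\cdot f$ with $\sigma\in\mathfrak{S}_n$, $f\in L$. A property holds for a general $(r,d)$-symmetric ideal if there is a nonempty Zariski open $U\subseteq\operatorname{Gr}_k(r,R_d)$ such that the property holds for $(L)_{\mathfrak{S}_n}$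 for all $L\in U$. *)

theory Defs
  imports
    "HOL-Library.Poly_Mapping"
    "HOL-Library.Cardinality"
    "Jordan_Normal_Form.Determinant"
begin

section \<open>Polynomials\<close>

text \<open>The whole type \<open>('n, 'k) mpoly\<close> is the polynomial ring over \<open>'k\<close> with
  one variable for each element of \<open>'n\<close>; for a finite index type \<open>'n\<close> it is
  $k[x_1,\dots,x_n]$ with $n$ = \<open>CARD('n)\<close>. The same type, with Pluecker indices as
  variables, serves for the equations of closed subsets of the Grassmannian.\<close>

type_synonym 'v mon = "'v \<Rightarrow>\<^sub>0 nat"
type_synonym ('v, 'k) mpoly = "'v mon \<Rightarrow>\<^sub>0 'k"

definition Const :: "'k::zero \<Rightarrow> ('v, 'k) mpoly" where
  "Const c = Poly_Mapping.single 0 c"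

definition Var :: "'v \<Rightarrow> ('v, 'k::zero_neq_one) mpoly" where
  "Var i = Poly_Mapping.single (Poly_Mapping.single i 1) 1"

text \<open>Evaluation at \<open>a\<close>, with the coefficients mapped by \<open>\<phi>\<close>.\<close>

definition mp_eval ::
  "('k::zero \<Rightarrow> 'b::comm_semiring_1) \<Rightarrow> ('v \<Rightarrow> 'b) \<Rightarrow> ('v, 'k) mpoly \<Rightarrow> 'b" where
  "mp_eval \<phi> a f =
     (\<Sum>m\<in>Poly_Mapping.keys f. \<phi> (Poly_Mapping.lookup f m) *
        (\<Prod>i\<in>Poly_Mapping.keys m. a i ^ Poly_Mapping.lookup m i))"

definition mon_deg :: "'v mon \<Rightarrow> nat" where
  "mon_deg m = (\<Sum>i\<in>Poly_Mapping.keys m. Poly_Mapping.lookup m i)"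

definition hom_comp :: "nat \<Rightarrow> ('v, 'k::zero) mpoly set" where
  "hom_comp d = {f. \<forall>m\<in>Poly_Mapping.keys f. mon_deg m = d}"

definition mp_scale :: "'k::comm_semiring_1 \<Rightarrow> ('v, 'k) mpoly \<Rightarrow> ('v, 'k) mpoly" where
  "mp_scale c f = Const c * f"

global_interpretation mp: Vector_Spaces.vector_space
  "mp_scale :: 'k::field \<Rightarrow> ('v, 'k) mpoly \<Rightarrow> ('v, 'k) mpoly"
  by unfold_locales
    (simp_all add: mp_scale_def Const_def distrib_left single_add distrib_right
      mult_single mult.assoc[symmetric] single_one)

text \<open>Ideals of a commutative ring are its submodules as a module over itself.\<close>

definition ideal_gen :: "'a::comm_ring_1 set \<Rightarrow> 'a set" where
  "ideal_gen S = Modules.module.span (*) S"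


section \<open>The action of the symmetric group\<close>

definition perm_act :: "('n \<Rightarrow> 'n) \<Rightarrow> ('n, 'k::comm_semiring_1) mpoly \<Rightarrow> ('n, 'k) mpoly" where
  "perm_act \<sigma> f = mp_eval Const (\<lambda>i. Var (\<sigma> i)) f"

definition sym_submodule :: "('n::finite, 'k::field) mpoly set \<Rightarrow> bool" where
  "sym_submodule M \<longleftrightarrow>
     mp.subspace M \<and> (\<forall>\<sigma>. bij \<sigma> \<longrightarrow> (\<forall>f\<in>M. perm_act \<sigma> f \<in> M))"

text \<open>Generators may be repeated, so being generated by \<open>r\<close> elements means being
  generated by a set of at most \<open>r\<close> elements.\<close>

definition r_generated :: "nat \<Rightarrow> ('n::finite, 'k::field) mpoly set \<Rightarrow> bool" where
  "r_generated r M \<longleftrightarrow> (\<exists>G. finite G \<and> card G \<le> r \<and> M = sym_submodule hull G)"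

definition maximal_r_generated ::
  "nat \<Rightarrow> nat \<Rightarrow> ('n::finite, 'k::field) mpoly set \<Rightarrow> bool" where
  "maximal_r_generated r d M \<longleftrightarrow>
     M \<subseteq> hom_comp d \<and> r_generated r M \<and>
     (\<forall>N. N \<subseteq> hom_comp d \<and> r_generated r N \<and> M \<subseteq> N \<longrightarrow> N = M)"

definition sym_ideal :: "('n::finite, 'k::field) mpoly set \<Rightarrow> ('n, 'k) mpoly set" where
  "sym_ideal L = ideal_gen {perm_act \<sigma> f | \<sigma> f. bij \<sigma> \<and> f \<in> L}"


section \<open>The Grassmannian and its Zariski topology\<close>

definition Gr :: "nat \<Rightarrow> nat \<Rightarrow> ('n::finite, 'k::field) mpoly set set" where
  "Gr r d = {L. mp.subspace L \<and> L \<subseteq> hom_comp d \<and> mp.dim L = r}"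

definition ordered_basis :: "('n::finite, 'k::field) mpoly set \<Rightarrow> ('n, 'k) mpoly list \<Rightarrow> bool" where
  "ordered_basis L vs \<longleftrightarrow>
     distinct vs \<and> mp.independent (set vs) \<and> mp.span (set vs) = L"

text \<open>Pluecker coordinates with respect to the monomial basis of the degree \<open>d\<close> component.
  They are indexed by all \<open>r\<close>-tuples of monomials rather than the increasing ones. The
  additional coordinates are zero or, up to sign, equal to one indexed by an increasing
  tuple, so the induced topology is the usual one.\<close>

definition plucker_index :: "nat \<Rightarrow> nat \<Rightarrow> 'n mon list set" where
  "plucker_index r d = {ms. length ms = r \<and> (\<forall>m\<in>set ms. mon_deg m = d)}"

definition plucker_coord :: "('n, 'k::field) mpoly list \<Rightarrow> 'n mon list \<Rightarrow> 'k" where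
  "plucker_coord vs ms =
     det (mat (length vs) (length vs) (\<lambda>(i, j). Poly_Mapping.lookup (vs ! i) (ms ! j)))"

text \<open>The homogeneous coordinate vectors of the Pluecker point of \<open>L\<close> are those
  of the ordered bases of \<open>L\<close>. A homogeneous polynomial vanishes at all of them as soon as
  it vanishes at one.\<close>

definition zariski_closed_Gr ::
  "nat \<Rightarrow> nat \<Rightarrow> ('n::finite, 'k::field) mpoly set set \<Rightarrow> bool" where
  "zariski_closed_Gr r d Z \<longleftrightarrow>
     (\<exists>F :: ('n mon list, 'k) mpoly set.
        (\<forall>f\<in>F. (\<exists>e. f \<in> hom_comp e) \<and>
               (\<forall>m\<in>Poly_Mapping.keys f. Poly_Mapping.keys m \<subseteq> plucker_index r d)) \<and>
        Z = {L \<in> Gr r d. \<forall>f\<in>F. \<forall>vs. ordered_basis L vs \<longrightarrow>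
               mp_eval id (plucker_coord vs) f = 0})"

definition zariski_open_Gr ::
  "nat \<Rightarrow> nat \<Rightarrow> ('n::finite, 'k::field) mpoly set set \<Rightarrow> bool" where
  "zariski_open_Gr r d U \<longleftrightarrow> U \<subseteq> Gr r d \<and> zariski_closed_Gr r d (Gr r d - U)"

definition general_sym_ideal ::
  "nat \<Rightarrow> nat \<Rightarrow> (('n::finite, 'k::field) mpoly set \<Rightarrow> bool) \<Rightarrow> bool" where
  "general_sym_ideal r d P \<longleftrightarrow>
     (\<exists>U. zariski_open_Gr r d U \<and> U \<noteq> {} \<and> (\<forall>L\<in>U. P (sym_ideal L)))"

end

theory Submission
  imports Defs "HOL-Library.Function_Algebras"
begin

text \<open>Let \<open>V\<close> be the degree \<open>d\<close> component and \<open>A\<close> the group algebra of the symmetric group. A product of a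
  form of degree \<open>d\<close> with a polynomial contributes to degree \<open>d\<close> only through the constant term of the
  polynomial, so the degree \<open>d\<close> component of the ideal of \<open>L\<close> is the submodule \<open>A L\<close> generated by \<open>L\<close>
  (\<open>sym_ideal_Int_hom_comp\<close>). Let \<open>D\<close> be the largest dimension of an \<open>r\<close>-generated submodule of \<open>V\<close>.
  The open set is \<open>U = {L. dim (A L) = D}\<close>. It is nonempty because the generators of a submodule of
  dimension \<open>D\<close> lie in some \<open>r\<close>-dimensional \<open>L\<close>. For \<open>L\<close> in \<open>U\<close>, no \<open>r\<close>-generated submodule of \<open>V\<close> can
  be strictly larger than \<open>A L\<close>. Two points remain.

  \<^emph>\<open>Every maximal \<open>r\<close>-generated submodule has dimension \<open>D\<close>\<close> (\<open>dim_le_of_maximal_r_generated\<close>). The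
  \<open>r\<close>-generated submodules of \<open>V\<close> are the images of equivariant maps \<open>\<theta>: A\<^sup>r \<rightarrow> V\<close>. Let \<open>M\<close> be the image of
  \<open>\<phi>\<close>. By averaging, where the hypothesis on the characteristic enters, \<open>\<phi>\<close> has an equivariant
  quasi-inverse \<open>s\<close>; so \<open>p = s \<phi>\<close> is a projection of \<open>A\<^sup>r\<close> along the kernel of \<open>\<phi>\<close>, and \<open>q = \<phi> s\<close> is a
  projection of \<open>V\<close> onto \<open>M\<close>. For each \<open>\<theta>\<close> the map \<open>\<phi> + (1 - q) \<theta> (1 - p)\<close> has an image that contains \<open>M\<close>,
  so if \<open>M\<close> is maximal then \<open>(1 - q) \<theta> (1 - p) = 0\<close>. In terms of irreducible constituents, the kernel of
  \<open>\<phi>\<close> and a complement of \<open>M\<close> have none in common. Rather than decompose into isotypic components,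
  \<open>dim_range_le_of_quasi_inverse\<close> compares the ranks of \<open>\<theta>\<close> and \<open>\<phi>\<close> by means of the submodules of \<open>A\<^sup>r\<close>
  and \<open>V\<close> generated by all equivariant images of the kernel of \<open>\<phi>\<close>.

  \<^emph>\<open>The set \<open>U\<close> is open\<close> (\<open>zariski_closed_dim_orbit_span_less\<close>). The condition \<open>dim (A L) < D\<close> says that
  minors of size \<open>D\<close> in the coefficients of the translates of a basis of \<open>L\<close> vanish. To write it in
  Pluecker coordinates, one uses bases whose coefficients are themselves Pluecker coordinates: if the
  coordinate \<open>P\<^sub>J\<close> of \<open>L\<close> is nonzero, then Cramer's rule shows that the vectors with coefficients
  \<open>m \<mapsto> P\<^sub>J\<^sub>[\<^sub>i\<^sub>:\<^sub>=\<^sub>m\<^sub>]\<close>, for \<open>i < r\<close>, form a basis of \<open>L\<close> (\<open>span_cramer_vectors\<close>). For every \<open>J\<close> these vectors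
  lie in \<open>L\<close>, so the minors built from them, for all \<open>J\<close> together, cut out the complement of \<open>U\<close>.\<close>


section \<open>The permutation action on coefficients\<close>

lemma lookup_mp_scale [simp]:
  "Poly_Mapping.lookup (mp_scale c f) m = c * Poly_Mapping.lookup f m"
proof -
  have "mp_scale c f = Poly_Mapping.map ((*) c) f"
    unfolding mp_scale_def Const_def by (rule mult_map_scale_conv_mult[symmetric])
  then show ?thesis by (simp add: Poly_Mapping.map.rep_eq when_def)
qed

lemma poly_mapping_induct_single [case_names zero add]:
  assumes "P 0" and "\<And>m c f. P f \<Longrightarrow> P (Poly_Mapping.single m c + f)"
  shows "P (f :: 'a \<Rightarrow>\<^sub>0 'b::monoid_add)"
proof (induction f rule: update_induct)
  case (update f u b)
  then have "Poly_Mapping.update u b f = Poly_Mapping.single u b + f"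
    by (intro poly_mapping_eqI) (auto simp add: lookup_update lookup_add lookup_single when_def in_keys_iff)
  then show ?case using update assms(2) by simp
qed (rule assms(1))

lemma prod_single_one:
  "(\<Prod>i\<in>A. Poly_Mapping.single (f i) (1 :: 'k::comm_semiring_1)) = 
    Poly_Mapping.single (\<Sum>i\<in>A. f i :: 'v mon) 1"
  by (induction A rule: infinite_finite_induct) (simp_all add: mult_single)

lemma Var_power: "Var i ^ e = Poly_Mapping.single (Poly_Mapping.single i e) (1 :: 'k::comm_semiring_1)"
  by (induction e) (simp_all add: Var_def mult_single single_add[symmetric])

text \<open>In coefficients, the substitution of variables is precomposition with a bijection of the monomials.
  This makes linearity, functoriality and the preservation of degrees immediate, without recourse to the
  evaluation homomorphism.\<close>

lemma lookup_perm_act: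
  assumes "bij \<sigma>"
  shows "Poly_Mapping.lookup (perm_act \<sigma> f) m = Poly_Mapping.lookup f (Poly_Mapping.map_key \<sigma> m)"
proof -
  have inj: "inj \<sigma>" using assms by (rule bij_is_inj)
  \<comment> \<open>The exponent vector that \<open>\<sigma>\<close> makes of \<open>m'\<close>; pulling back along \<open>\<sigma>\<close> inverts this.\<close>
  define push where "push m' = (\<Sum>i\<in>Poly_Mapping.keys m'. Poly_Mapping.single (\<sigma> i) (Poly_Mapping.lookup m' i))"
    for m' :: "'a mon"
  have "Poly_Mapping.lookup (push m') (\<sigma> i) = Poly_Mapping.lookup m' i" for m' i
    by (simp add: push_def lookup_sum lookup_single when_def inj_eq[OF inj] in_keys_iff)
  then have push_iff: "push m' = m \<longleftrightarrow> m' = Poly_Mapping.map_key \<sigma> m" for m'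
    using bij_is_surj[OF assms, unfolded surj_def]
    unfolding poly_mapping_eq_iff fun_eq_iff map_key.rep_eq[OF inj] comp_def by metis
  have "perm_act \<sigma> f = (\<Sum>m'\<in>Poly_Mapping.keys f. Poly_Mapping.single (push m') (Poly_Mapping.lookup f m'))"
    unfolding perm_act_def mp_eval_def Const_def Var_power prod_single_one push_def mult_single by simp
  then show ?thesis
    by (simp add: lookup_sum lookup_single when_def push_iff in_keys_iff)
qed

lemma perm_act_add: "bij \<sigma> \<Longrightarrow> perm_act \<sigma> (f + g) = perm_act \<sigma> f + perm_act \<sigma> g"
  and perm_act_scale: "bij \<sigma> \<Longrightarrow> perm_act \<sigma> (mp_scale c f) = mp_scale c (perm_act \<sigma> f)"
  by (simp_all add: poly_mapping_eq_iff fun_eq_iff lookup_perm_act lookup_add)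

lemma perm_act_comp:
  assumes "bij \<sigma>" "bij \<tau>"
  shows "perm_act \<sigma> (perm_act \<tau> f) = perm_act (\<sigma> \<circ> \<tau>) f"
  using assms
  by (simp add: poly_mapping_eq_iff fun_eq_iff lookup_perm_act bij_comp
      map_key_compose bij_is_inj)

lemma perm_act_id [simp]: "perm_act id f = f"
proof -
  have "Poly_Mapping.map_key id m = m" for m :: "'a mon"
    unfolding id_def by (rule map_key_id)
  then show ?thesis by (intro poly_mapping_eqI) (simp add: lookup_perm_act)
qed

lemma linear_perm_act: "bij \<sigma> \<Longrightarrow> Vector_Spaces.linear mp_scale mp_scale (perm_act \<sigma>)"
  by unfold_locales (simp_all add: perm_act_add perm_act_scale)

lemma mon_deg_map_key:
  assumes "bij \<sigma>"
  shows "mon_deg (Poly_Mapping.map_key \<sigma> m) = mon_deg m"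
proof -
  have inj: "inj \<sigma>" using assms by (rule bij_is_inj)
  have "mon_deg m = (\<Sum>i\<in>\<sigma> ` (\<sigma> -` Poly_Mapping.keys m). Poly_Mapping.lookup m i)"
    using bij_is_surj[OF assms] by (simp add: mon_deg_def surj_image_vimage_eq)
  also have "\<dots> = (\<Sum>i\<in>\<sigma> -` Poly_Mapping.keys m. Poly_Mapping.lookup m (\<sigma> i))"
    using inj by (subst sum.reindex) (auto intro: inj_on_subset)
  finally show ?thesis
    by (simp add: mon_deg_def keys_map_key[OF inj] map_key.rep_eq[OF inj])
qed

lemma mem_hom_comp_iff:
  "f \<in> hom_comp d \<longleftrightarrow> (\<forall>m. mon_deg m \<noteq> d \<longrightarrow> Poly_Mapping.lookup f m = 0)"
  by (auto simp: hom_comp_def in_keys_iff)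

lemma subspace_hom_comp: "mp.subspace (hom_comp d :: ('v, 'k::field) mpoly set)"
  by (auto simp: mp.subspace_def mem_hom_comp_iff lookup_add)

lemma perm_act_hom_comp: "bij \<sigma> \<Longrightarrow> f \<in> hom_comp d \<Longrightarrow> perm_act \<sigma> f \<in> hom_comp d"
  by (simp add: mem_hom_comp_iff lookup_perm_act mon_deg_map_key)

lemma mon_deg_add: "mon_deg (m + m') = mon_deg m + mon_deg m'"
proof -
  have *: "mon_deg m = (\<Sum>i\<in>S. Poly_Mapping.lookup m i)"
    if "finite S" "Poly_Mapping.keys m \<subseteq> S" for S and m :: "'v mon"
    unfolding mon_deg_def using that by (intro sum.mono_neutral_left) (auto simp: in_keys_iff)
  let ?S = "Poly_Mapping.keys m \<union> Poly_Mapping.keys m'"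
  show ?thesis
    using Poly_Mapping.keys_add[of m m']
    by (simp add: *[of ?S m] *[of ?S m'] *[of ?S "m + m'"] lookup_add sum.distrib)
qed

lemma finite_monomials_of_degree: "finite {m :: 'n::finite mon. mon_deg m = d}"
proof (rule finite_subset)
  have "Poly_Mapping.lookup m i \<le> d" if "mon_deg m = d" for m :: "'n mon" and i
  proof (cases "i \<in> Poly_Mapping.keys m")
    case True
    then show ?thesis using that member_le_sum[of i "Poly_Mapping.keys m" "Poly_Mapping.lookup m"]
      by (simp add: mon_deg_def)
  qed (simp add: in_keys_iff)
  then show "{m :: 'n mon. mon_deg m = d} \<subseteq> Poly_Mapping.lookup -` {h. \<forall>i. h i \<in> {..d}}"
    by auto
  have "{h :: 'n \<Rightarrow> nat. \<forall>i. h i \<in> {..d}} = (UNIV \<rightarrow>\<^sub>E {..d})" by (auto simp: PiE_def extensional_def)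
  then have "finite {h :: 'n \<Rightarrow> nat. \<forall>i. h i \<in> {..d}}" by (simp add: finite_PiE)
  then show "finite (Poly_Mapping.lookup -` {h :: 'n \<Rightarrow> nat. \<forall>i. h i \<in> {..d}})"
    by (rule finite_vimageI) (simp add: inj_on_def lookup_inject)
qed

lemma hom_comp_finitely_spanned:
  obtains F :: "('n::finite, 'k::field) mpoly set" where "finite F" "hom_comp d \<subseteq> mp.span F"
proof
  let ?F = "(\<lambda>m. Poly_Mapping.single m 1) ` {m :: 'n mon. mon_deg m = d} :: ('n, 'k) mpoly set"
  show "finite ?F" by (intro finite_imageI finite_monomials_of_degree)
  show "hom_comp d \<subseteq> mp.span ?F"
  proof
    fix f :: "('n, 'k) mpoly" assume f: "f \<in> hom_comp d"
    have "f = (\<Sum>m\<in>Poly_Mapping.keys f. mp_scale (Poly_Mapping.lookup f m) (Poly_Mapping.single m 1))"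
      by (intro poly_mapping_eqI) (simp add: lookup_sum lookup_single when_def in_keys_iff if_distrib cong: if_cong)
    also have "\<dots> \<in> mp.span ?F"
      using f by (intro mp.span_sum mp.span_scale mp.span_base) (auto simp: hom_comp_def)
    finally show "f \<in> mp.span ?F" .
  qed
qed

section \<open>Submodules generated by a set, and the degree component of an ideal\<close>

definition orbit_span :: "('n::finite, 'k::field) mpoly set \<Rightarrow> ('n, 'k) mpoly set" where
  "orbit_span S = mp.span {perm_act \<sigma> f | \<sigma> f. bij \<sigma> \<and> f \<in> S}"

lemma sym_submodule_orbit_span: "sym_submodule (orbit_span S)"
proof -
  let ?S = "{perm_act \<sigma> f | \<sigma> f. bij \<sigma> \<and> f \<in> S}"
  have "perm_act \<sigma> f \<in> orbit_span S" if \<sigma>: "bij \<sigma>" and f: "f \<in> orbit_span S" for \<sigma> f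
  proof -
    interpret Vector_Spaces.linear mp_scale mp_scale "perm_act \<sigma>" by (rule linear_perm_act[OF \<sigma>])
    have "perm_act \<sigma> ` ?S \<subseteq> ?S"
      using \<sigma> by (auto simp: perm_act_comp) (metis bij_comp)
    then have "perm_act \<sigma> ` mp.span ?S \<subseteq> mp.span ?S"
      by (simp add: span_image[symmetric] mp.span_mono)
    then show ?thesis using f by (auto simp: orbit_span_def)
  qed
  then show ?thesis
    by (simp add: sym_submodule_def orbit_span_def)
qed

lemma hull_eq_orbit_span: "sym_submodule hull S = orbit_span S"
proof (rule hull_unique)
  show "S \<subseteq> orbit_span S"
  proof
    fix f assume "f \<in> S"
    then have "perm_act id f \<in> {perm_act \<sigma> f | \<sigma> f. bij \<sigma> \<and> f \<in> S}" using bij_id by blast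
    then show "f \<in> orbit_span S" unfolding orbit_span_def by (simp add: mp.span_base)
  qed
  show "orbit_span S \<subseteq> T" if "S \<subseteq> T" "sym_submodule T" for T
    unfolding orbit_span_def using that by (intro mp.span_minimal) (auto simp: sym_submodule_def)
qed (rule sym_submodule_orbit_span)

lemma orbit_span_mono: "S \<subseteq> T \<Longrightarrow> orbit_span S \<subseteq> orbit_span T"
  unfolding hull_eq_orbit_span[symmetric] by (rule hull_mono)

lemma orbit_span_eqI: "S \<subseteq> T \<Longrightarrow> T \<subseteq> orbit_span S \<Longrightarrow> orbit_span T = orbit_span S"
  using sym_submodule_orbit_span[of S] 
  by (metis hull_eq_orbit_span hull_minimal orbit_span_mono subset_antisym)

lemma orbit_span_superset: "S \<subseteq> orbit_span S"
  unfolding hull_eq_orbit_span[symmetric] by (rule hull_subset)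

lemma subspace_orbit_span [simp]: "mp.subspace (orbit_span S)"
  by (simp add: orbit_span_def)

lemma orbit_span_span: "orbit_span (mp.span S) = orbit_span S"
  by (rule orbit_span_eqI) (simp_all add: mp.span_superset mp.span_minimal orbit_span_superset)

lemma orbit_span_hom_comp: "S \<subseteq> hom_comp d \<Longrightarrow> orbit_span S \<subseteq> hom_comp d"
  unfolding orbit_span_def 
  by (intro mp.span_minimal subspace_hom_comp) (auto intro: perm_act_hom_comp)

text \<open>For \<open>s\<close> of degree \<open>d\<close>, the degree \<open>d\<close> part of \<open>c s\<close> is the constant term of \<open>c\<close> times \<open>s\<close>. Hence the
  degree \<open>d\<close> part of any combination of elements of \<open>S\<close> with polynomial coefficients is a combination
  with scalar coefficients.\<close>

lemma ideal_Int_hom_comp: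
  fixes S :: "('v, 'k::field) mpoly set"
  assumes S: "S \<subseteq> hom_comp d"
  shows "ideal_gen S \<inter> hom_comp d = mp.span S"
proof -
  interpret I: Modules.module "(*) :: ('v, 'k) mpoly \<Rightarrow> _" 
    by unfold_locales (simp_all add: algebra_simps)
  \<comment> \<open>\<open>g\<close> is the homogeneous part of degree \<open>d\<close> of \<open>f\<close>.\<close>
  define top where "top f g \<longleftrightarrow> g \<in> hom_comp d \<and>
     (\<forall>m. mon_deg m = d \<longrightarrow> Poly_Mapping.lookup g m = Poly_Mapping.lookup f m)"
    for f g :: "('v, 'k) mpoly"
  have mult: "Poly_Mapping.lookup (c * x) m = Poly_Mapping.lookup c 0 * Poly_Mapping.lookup x m"
    if "x \<in> S" "mon_deg m = d" for c x m
  proof -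
    have "Poly_Mapping.lookup (Poly_Mapping.single m' a * x) m = (if m' = 0 then a * Poly_Mapping.lookup x m else 0)" for m' a
    proof (cases "m' = 0")
      case True
      then have "Poly_Mapping.single m' a * x = mp_scale a x" by (simp add: mp_scale_def Const_def)
      then show ?thesis using True by simp
    next
      case False
      have "m \<notin> Poly_Mapping.keys (Poly_Mapping.single m' a * x)"
      proof
        assume "m \<in> Poly_Mapping.keys (Poly_Mapping.single m' a * x)"
        then obtain u where "m = m' + u" "u \<in> Poly_Mapping.keys x"
          using Poly_Mapping.keys_mult[of "Poly_Mapping.single m' a" x] by (auto split: if_splits)
        moreover have "mon_deg u = d" using S \<open>x \<in> S\<close> \<open>u \<in> _\<close> by (auto simp: hom_comp_def)
        moreover have "mon_deg m' \<noteq> 0" using False by (simp add: mon_deg_def in_keys_iff poly_mapping_eq_iff fun_eq_iff)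
        ultimately show False using that(2) by (simp add: mon_deg_add)
      qed
      then show ?thesis using False by (simp add: in_keys_iff)
    qed
    note single = this
    show ?thesis
      by (induction c rule: poly_mapping_induct_single)
        (simp_all add: distrib_right lookup_add single lookup_single when_def)
  qed
  have "\<exists>g\<in>mp.span S. top f g" if "f \<in> ideal_gen S" for f
    using that unfolding ideal_gen_def
  proof (induction f rule: I.span_induct_alt)
    case base
    show ?case by (rule bexI[of _ 0]) (auto simp: top_def mem_hom_comp_iff mp.span_zero)
  next
    case (step c x y)
    then obtain g where g: "g \<in> mp.span S" "top y g" by blast
    have "mp_scale (Poly_Mapping.lookup c 0) x + g \<in> mp.span S"
      using step(1) g by (simp add: mp.span_add mp.span_scale mp.span_base)
    moreover have "top (c * x + y) (mp_scale (Poly_Mapping.lookup c 0) x + g)"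
      using g(2) mult[OF step(1)] step(1) S by (auto simp: top_def mem_hom_comp_iff lookup_add)
    ultimately show ?case by blast
  qed
  moreover have "f = g" if "f \<in> hom_comp d" "top f g" for f g
    using that by (auto simp: top_def mem_hom_comp_iff poly_mapping_eq_iff fun_eq_iff) metis
  moreover have "mp.span S \<subseteq> ideal_gen S"
  proof
    show "f \<in> ideal_gen S" if "f \<in> mp.span S" for f
      using that unfolding ideal_gen_def
    proof (induction f rule: mp.span_induct_alt)
      case (step c x y)
      then show ?case by (simp add: mp_scale_def I.span_add I.span_scale I.span_base)
    qed (simp add: I.span_zero)
  qed
  moreover have "mp.span S \<subseteq> hom_comp d" using S by (simp add: mp.span_minimal subspace_hom_comp)
  ultimately show ?thesis by blast
qed

lemma sym_ideal_Int_hom_comp: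
  "L \<subseteq> hom_comp d \<Longrightarrow> sym_ideal L \<inter> hom_comp d = orbit_span L"
  unfolding sym_ideal_def orbit_span_def
  by (rule ideal_Int_hom_comp) (auto intro: perm_act_hom_comp)

section \<open>Dimension inside a finitely spanned subspace\<close>

text \<open>The polynomial ring has infinite dimension, so the monotonicity of \<open>dim\<close> has to be derived from a finite
  set \<open>F\<close> whose span contains the subspaces in question.\<close>

lemma (in vector_space) dim_mono_finitely_spanned:
  assumes "A \<subseteq> B" "B \<subseteq> span F" "finite F"
  shows "dim A \<le> dim B"
proof -
  obtain C where C: "C \<subseteq> B" "independent C" "B \<subseteq> span C" "card C = dim B"
    by (rule basis_exists)
  have "finite C" using independent_span_bound[OF assms(3) C(2)] C(1) assms(2) by blast
  then have "dim A \<le> card C" using assms(1) C(3) by (intro dim_le_card) auto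
  then show ?thesis using C(4) by simp
qed

lemma (in vector_space) independent_card_le_dim_finitely_spanned:
  assumes "A \<subseteq> B" "independent A" "B \<subseteq> span F" "finite F"
  shows "finite A \<and> card A \<le> dim B"
proof -
  have "dim A \<le> dim B" by (rule dim_mono_finitely_spanned[OF assms(1,3,4)])
  moreover have "finite A" using independent_span_bound[OF assms(4,2)] assms(1,3) by blast
  ultimately show ?thesis using assms(2) by (simp add: dim_eq_card_independent)
qed

lemma (in vector_space) subspace_eq_finitely_spanned:
  assumes "subspace A" "A \<subseteq> B" "dim B \<le> dim A" "B \<subseteq> span F" "finite F"
  shows "A = B"
proof -
  obtain C where C: "C \<subseteq> A" "independent C" "A \<subseteq> span C" "card C = dim A"
    by (rule basis_exists)
  have "B \<subseteq> span C"
  proof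
    fix x assume x: "x \<in> B"
    show "x \<in> span C"
    proof (rule ccontr)
      assume nx: "x \<notin> span C"
      then have "independent (insert x C)" "x \<notin> C" using C(2) by (auto simp: independent_insertI span_base)
      moreover have "insert x C \<subseteq> B" using x C(1) assms(2) by auto
      ultimately have "finite (insert x C) \<and> card (insert x C) \<le> dim B" "x \<notin> C"
        using independent_card_le_dim_finitely_spanned[of "insert x C", OF _ _ assms(4,5)] by auto
      moreover have "finite C" using calculation by simp
      ultimately show False using C(4) assms(3) by simp
    qed
  qed
  also have "span C \<subseteq> A" using C(1) assms(1) by (rule span_minimal)
  finally show ?thesis using assms(2) by auto
qed

section \<open>The rank of a maximal equivariant map\<close>

text \<open>Write \<open>p = s \<phi>\<close> and \<open>q = \<phi> s\<close>; the assumption \<open>corner\<close> says \<open>(1 - q) \<theta> (1 - p) = 0\<close> for all \<open>\<theta>\<close> in \<open>H\<close>.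
  Let \<open>T1\<close> (below: \<open>span S1\<close>) be spanned by all \<open>a (1 - p) x\<close> with \<open>a\<close> in \<open>E\<close>, and \<open>T2\<close> (below: \<open>span S2\<close>) by
  all \<open>\<theta> (1 - p) x\<close> with \<open>\<theta>\<close> in \<open>H\<close>. Then \<open>\<theta> T1 \<subseteq> T2\<close>, and \<open>corner\<close> gives \<open>T2 \<subseteq> \<phi> T1\<close>, because
  \<open>\<theta> (1 - p) = \<phi> (s \<theta>) (1 - p)\<close>. Since \<open>T1\<close> contains the kernel of \<open>\<phi>\<close>, the codimension of \<open>T1\<close> in the
  whole space equals that of \<open>\<phi> T1\<close> in the image of \<open>\<phi>\<close>. Therefore \<open>\<theta>\<close> has rank at most \<open>dim (\<phi> T1)\<close> plus
  this codimension, which is the rank of \<open>\<phi>\<close>. In the application, \<open>H\<close> and \<open>E\<close> are sets of equivariant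
  maps.\<close>

lemma (in vector_space_pair) dim_range_le_of_quasi_inverse:
  fixes \<phi> :: "'b \<Rightarrow> 'c" and s :: "'c \<Rightarrow> 'b"
    and H :: "('b \<Rightarrow> 'c) set" and E :: "('b \<Rightarrow> 'b) set"
  defines "kpr \<equiv> \<lambda>x. x - s (\<phi> x)"
  assumes lin: "\<And>\<theta>. \<theta> \<in> H \<Longrightarrow> Vector_Spaces.linear s1 s2 \<theta>"
    and \<phi>: "\<phi> \<in> H" and id: "id \<in> E"
    and sH: "\<And>\<theta>. \<theta> \<in> H \<Longrightarrow> s \<circ> \<theta> \<in> E"
    and HE: "\<And>\<theta> a. \<theta> \<in> H \<Longrightarrow> a \<in> E \<Longrightarrow> \<theta> \<circ> a \<in> H"
    and s0: "s 0 = 0"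
    and corner: "\<And>\<theta> x. \<theta> \<in> H \<Longrightarrow> \<phi> (s (\<theta> (kpr x))) = \<theta> (kpr x)"
    and fin: "finite F" "range \<phi> \<subseteq> vs2.span F"
    and \<theta>: "\<theta> \<in> H"
  shows "vs2.dim (range \<theta>) \<le> vs2.dim (range \<phi>)"
proof -
  interpret \<phi>: Vector_Spaces.linear s1 s2 \<phi> by (rule lin[OF \<phi>])
  interpret \<theta>: Vector_Spaces.linear s1 s2 \<theta> by (rule lin[OF \<theta>])
  define S1 where "S1 = (\<Union>a\<in>E. range (a \<circ> kpr))"
  define S2 where "S2 = (\<Union>\<eta>\<in>H. range (\<eta> \<circ> kpr))"
  have "\<theta> ` S1 \<subseteq> S2"
    unfolding S1_def S2_def using HE[OF \<theta>] by (fastforce simp: image_iff comp_def)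
  then have \<theta>T: "\<theta> ` vs1.span S1 \<subseteq> vs2.span S2"
    by (simp add: \<theta>.span_image[symmetric] vs2.span_mono)
  have "S2 \<subseteq> \<phi> ` S1"
  proof
    fix y assume "y \<in> S2"
    then obtain \<eta> x where \<eta>: "\<eta> \<in> H" "y = \<eta> (kpr x)" by (auto simp: S2_def)
    then have "y = \<phi> (s (\<eta> (kpr x)))" using corner by simp
    moreover have "s (\<eta> (kpr x)) \<in> S1" unfolding S1_def by (rule UN_I[OF sH[OF \<eta>(1)]]) auto
    ultimately show "y \<in> \<phi> ` S1" by blast
  qed
  then have T2: "vs2.span S2 \<subseteq> \<phi> ` vs1.span S1"
    by (simp add: \<phi>.span_image[symmetric] vs2.span_mono)
  have kpr: "kpr x \<in> vs1.span S1" for x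
    unfolding S1_def by (rule vs1.span_base, rule UN_I[OF id]) auto
  have ker: "x \<in> vs1.span S1" if "\<phi> x = 0" for x
    using kpr[of x] that s0 by (simp add: kpr_def)
  obtain B0 where B0: "B0 \<subseteq> \<phi> ` vs1.span S1" "vs2.independent B0" "\<phi> ` vs1.span S1 \<subseteq> vs2.span B0"
    by (rule vs2.basis_exists)
  have "B0 \<subseteq> range \<phi>" using B0(1) by auto
  obtain B where B: "B0 \<subseteq> B" "B \<subseteq> range \<phi>" "vs2.independent B" "range \<phi> \<subseteq> vs2.span B"
    by (rule vs2.maximal_independent_subset_extend[OF \<open>B0 \<subseteq> range \<phi>\<close> B0(2)])
  have finB: "finite B" using vs2.independent_span_bound[OF fin(1) B(3)] B(2) fin(2) by blast
  have "\<forall>b\<in>B - B0. \<exists>x. \<phi> x = b" using B(2) by auto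
  then obtain pre where pre: "\<And>b. b \<in> B - B0 \<Longrightarrow> \<phi> (pre b) = b" by metis
  \<comment> \<open>\<open>C\<close> spans a complement of \<open>span S1\<close>: it lifts a basis of the image of \<open>\<phi>\<close> modulo that of \<open>span S1\<close>.\<close>
  define C where "C = pre ` (B - B0)"
  have \<phi>C: "\<phi> ` C = B - B0" using pre by (force simp: C_def)
  have "range \<theta> \<subseteq> vs2.span (B0 \<union> \<theta> ` C)"
  proof clarify
    fix x
    have "B = B0 \<union> \<phi> ` C" using B(1) \<phi>C by auto
    then have "\<phi> x \<in> vs2.span (B0 \<union> \<phi> ` C)" using B(4) by blast
    then obtain u c where uc: "\<phi> x = u + \<phi> c" "u \<in> vs2.span B0" "c \<in> vs1.span C"
      unfolding vs2.span_Un \<phi>.span_image by blast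
    have "vs2.span B0 \<subseteq> \<phi> ` vs1.span S1"
      using B0(1) unfolding \<phi>.span_image[symmetric] by (simp add: vs2.span_minimal)
    then obtain t where t: "u = \<phi> t" "t \<in> vs1.span S1" using uc(2) by auto
    have "x - t - c \<in> vs1.span S1"
      by (rule ker) (simp add: \<phi>.diff uc t)
    then have "\<theta> (t + (x - t - c)) \<in> vs2.span B0"
      using t(2) \<theta>T T2 B0(3) vs1.span_add by blast
    moreover have "\<theta> c \<in> vs2.span (\<theta> ` C)" using uc(3) by (simp add: \<theta>.span_image)
    moreover have "\<theta> x = \<theta> (t + (x - t - c)) + \<theta> c" by (simp add: \<theta>.add[symmetric])
    ultimately show "\<theta> x \<in> vs2.span (B0 \<union> \<theta> ` C)" unfolding vs2.span_Un by blast
  qed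
  moreover have finB0: "finite B0" "finite (B - B0)" using finB B(1) finite_subset by auto
  ultimately have "vs2.dim (range \<theta>) \<le> card (B0 \<union> \<theta> ` C)"
    by (intro vs2.dim_le_card) (auto simp: C_def)
  also have "\<dots> \<le> card B0 + card (\<theta> ` C)" by (rule card_Un_le)
  also have "card (\<theta> ` C) \<le> card (B - B0)"
    unfolding C_def image_image using finB0 by (intro card_image_le)
  also have "card B0 + card (B - B0) = card B"
    using finB B(1) by (simp add: card_Diff_subset card_mono finB0)
  also have "card B = vs2.dim (range \<phi>)" using B by (intro vs2.basis_card_eq_dim)
  finally show ?thesis by simp
qed

section \<open>Averaging over the symmetric group\<close>

lemma of_nat_card_bij_neq_0:
  assumes "CHAR('k::field) = 0 \<or> CHAR('k) > CARD('n::finite)"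
  shows "of_nat (card {\<sigma> :: 'n \<Rightarrow> 'n. bij \<sigma>}) \<noteq> (0 :: 'k)"
proof -
  have "{\<sigma> :: 'n \<Rightarrow> 'n. bij \<sigma>} = {\<sigma>. \<sigma> permutes UNIV}"
    by (auto intro: bij_imp_permutes dest: permutes_bij)
  then have "card {\<sigma> :: 'n \<Rightarrow> 'n. bij \<sigma>} = fact CARD('n)" by (simp add: card_permutations)
  moreover have "of_nat (fact m) \<noteq> (0 :: 'k)" if "m \<le> CARD('n)" for m
    using that
  proof (induction m)
    case (Suc m)
    then have "\<not> CHAR('k) dvd Suc m" using assms by (auto dest: dvd_imp_le)
    then have "of_nat (Suc m) \<noteq> (0 :: 'k)" by (simp only: of_nat_eq_0_iff_char_dvd not_False_eq_True)
    then show ?case using Suc by (simp only: fact_Suc of_nat_mult) simp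
  qed simp
  ultimately show ?thesis by simp
qed

lemma bij_betw_comp_left: "bij \<sigma> \<Longrightarrow> bij_betw ((\<circ>) \<sigma>) {\<tau>. bij \<tau>} {\<tau>. bij \<tau>}"
  by (rule bij_betw_byWitness[where f' = "(\<circ>) (inv_into UNIV \<sigma>)"])
    (auto simp: fun_eq_iff bij_comp bij_imp_bij_inv bij_is_inj bij_is_surj surj_f_inv_f)

text \<open>Maschke's theorem in the form of a quasi-inverse. Choose any linear \<open>s0\<close> with \<open>\<phi> s0 \<phi> = \<phi>\<close> and average its
  conjugates \<open>\<sigma> s0 \<sigma>\<^sup>-\<^sup>1\<close>; each conjugate still satisfies the equation because \<open>\<phi>\<close> is equivariant. A single
  quasi-inverse provides a complement of the kernel and a complement of the image at once.\<close>

lemma (in vector_space_pair) equivariant_quasi_inverse: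
  fixes \<rho>1 :: "('n::finite \<Rightarrow> 'n) \<Rightarrow> 'b \<Rightarrow> 'b" and \<rho>2 :: "('n \<Rightarrow> 'n) \<Rightarrow> 'c \<Rightarrow> 'c"
  assumes char: "of_nat (card {\<sigma> :: 'n \<Rightarrow> 'n. bij \<sigma>}) \<noteq> (0 :: 'a)"
    and lin: "Vector_Spaces.linear s1 s2 \<phi>"
    and lin1: "\<And>\<sigma>. bij \<sigma> \<Longrightarrow> Vector_Spaces.linear s1 s1 (\<rho>1 \<sigma>)"
    and lin2: "\<And>\<sigma>. bij \<sigma> \<Longrightarrow> Vector_Spaces.linear s2 s2 (\<rho>2 \<sigma>)"
    and comp1: "\<And>\<sigma> \<tau> x. bij \<sigma> \<Longrightarrow> bij \<tau> \<Longrightarrow> \<rho>1 \<sigma> (\<rho>1 \<tau> x) = \<rho>1 (\<sigma> \<circ> \<tau>) x"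
    and comp2: "\<And>\<sigma> \<tau> y. bij \<sigma> \<Longrightarrow> bij \<tau> \<Longrightarrow> \<rho>2 \<sigma> (\<rho>2 \<tau> y) = \<rho>2 (\<sigma> \<circ> \<tau>) y"
    and id2: "\<And>y. \<rho>2 id y = y"
    and equi: "\<And>\<sigma> x. bij \<sigma> \<Longrightarrow> \<phi> (\<rho>1 \<sigma> x) = \<rho>2 \<sigma> (\<phi> x)"
  obtains s where "Vector_Spaces.linear s2 s1 s"
    and "\<And>\<sigma> y. bij \<sigma> \<Longrightarrow> s (\<rho>2 \<sigma> y) = \<rho>1 \<sigma> (s y)"
    and "\<And>x. \<phi> (s (\<phi> x)) = \<phi> x"
proof -
  define N where "N = (of_nat (card {\<sigma> :: 'n \<Rightarrow> 'n. bij \<sigma>}) :: 'a)"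
  obtain s0 where s0: "Vector_Spaces.linear s2 s1 s0" "\<And>x. \<phi> (s0 (\<phi> x)) = \<phi> x"
    using linear_exists_right_inverse_on[OF lin vs1.subspace_UNIV] by auto
  define s where "s y = s1 (inverse N) (\<Sum>\<sigma> | bij \<sigma>. \<rho>1 \<sigma> (s0 (\<rho>2 (inv_into UNIV \<sigma>) y)))" for y
  interpret \<phi>: Vector_Spaces.linear s1 s2 \<phi> by (rule lin)
  interpret s0: Vector_Spaces.linear s2 s1 s0 by (rule s0(1))
  have hom1: "module_hom s1 s1 (\<rho>1 \<sigma>)" if "bij \<sigma>" for \<sigma>
    using lin1[OF that] by (simp add: module_hom_iff_linear)
  have hom2: "module_hom s2 s2 (\<rho>2 \<sigma>)" if "bij \<sigma>" for \<sigma>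
    using lin2[OF that] by (simp add: module_hom_iff_linear)
  note add = module_hom.add[OF hom1] module_hom.add[OF hom2] s0.add
  note scale = module_hom.scale[OF hom1] module_hom.scale[OF hom2] s0.scale
  have "Vector_Spaces.linear s2 s1 s"
  proof (unfold_locales)
    show "s (x + y) = s x + s y" for x y
      by (simp add: s_def bij_imp_bij_inv add sum.distrib vs1.scale_right_distrib)
    show "s (s2 c x) = s1 c (s x)" for c x
      by (simp add: s_def bij_imp_bij_inv scale vs1.scale_sum_right mult.commute)
  qed
  moreover have "s (\<rho>2 \<sigma> y) = \<rho>1 \<sigma> (s y)" if \<sigma>: "bij \<sigma>" for \<sigma> y
  proof -
    interpret \<rho>: module_hom s1 s1 "\<rho>1 \<sigma>" by (rule hom1[OF \<sigma>])
    have "(\<Sum>\<tau> | bij \<tau>. \<rho>1 \<tau> (s0 (\<rho>2 (inv_into UNIV \<tau>) (\<rho>2 \<sigma> y))))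
        = (\<Sum>\<tau> | bij \<tau>. \<rho>1 (\<sigma> \<circ> \<tau>) (s0 (\<rho>2 (inv_into UNIV (\<sigma> \<circ> \<tau>)) (\<rho>2 \<sigma> y))))"
      by (rule sum.reindex_bij_betw[OF bij_betw_comp_left[OF \<sigma>], symmetric])
    also have "\<dots> = (\<Sum>\<tau> | bij \<tau>. \<rho>1 \<sigma> (\<rho>1 \<tau> (s0 (\<rho>2 (inv_into UNIV \<tau>) y))))"
    proof (rule sum.cong[OF refl], clarify)
      fix \<tau> :: "'n \<Rightarrow> 'n" assume \<tau>: "bij \<tau>"
      have "inv_into UNIV (\<sigma> \<circ> \<tau>) \<circ> \<sigma> = inv_into UNIV \<tau>"
        using \<sigma> \<tau> by (simp add: o_inv_distrib comp_assoc bij_is_inj)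
      then show "\<rho>1 (\<sigma> \<circ> \<tau>) (s0 (\<rho>2 (inv_into UNIV (\<sigma> \<circ> \<tau>)) (\<rho>2 \<sigma> y))) = \<rho>1 \<sigma> (\<rho>1 \<tau> (s0 (\<rho>2 (inv_into UNIV \<tau>) y)))"
        using \<sigma> \<tau> by (simp add: comp1 comp2 bij_comp bij_imp_bij_inv)
    qed
    finally show ?thesis by (simp add: s_def \<rho>.scale \<rho>.sum)
  qed
  moreover have "\<phi> (s (\<phi> x)) = \<phi> x" for x
  proof -
    have "\<phi> (\<rho>1 \<sigma> (s0 (\<rho>2 (inv_into UNIV \<sigma>) (\<phi> x)))) = \<phi> x" if \<sigma>: "bij \<sigma>" for \<sigma>
    proof -
      have "\<phi> (\<rho>1 \<sigma> (s0 (\<rho>2 (inv_into UNIV \<sigma>) (\<phi> x)))) = \<rho>2 \<sigma> (\<phi> (s0 (\<phi> (\<rho>1 (inv_into UNIV \<sigma>) x))))"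
        using \<sigma> by (simp add: equi bij_imp_bij_inv)
      also have "\<dots> = \<rho>2 \<sigma> (\<rho>2 (inv_into UNIV \<sigma>) (\<phi> x))"
        using \<sigma> by (simp add: s0(2)) (simp add: equi bij_imp_bij_inv)
      also have "\<sigma> \<circ> inv_into UNIV \<sigma> = id" by (rule surj_iff[THEN iffD1, OF bij_is_surj[OF \<sigma>]])
      then have "\<rho>2 \<sigma> (\<rho>2 (inv_into UNIV \<sigma>) (\<phi> x)) = \<phi> x" using \<sigma> by (simp add: comp2 bij_imp_bij_inv id2 del: id_apply)
      finally show ?thesis .
    qed
    then have "\<phi> (s (\<phi> x)) = s2 (inverse N) (\<Sum>\<sigma> | bij (\<sigma> :: 'n \<Rightarrow> 'n). \<phi> x)"
      by (simp add: s_def \<phi>.scale \<phi>.sum)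
    also have "\<dots> = s2 (inverse N * N) (\<phi> x)"
      by (simp add: N_def vs2.sum_constant_scale)
    finally show ?thesis using char by (simp add: N_def)
  qed
  ultimately show ?thesis by (rule that)
qed

section \<open>Submodules with r generators as images of a free module\<close>

text \<open>The free module of rank \<open>r\<close> over the group algebra is modelled by the functions on all of
  \<open>nat \<times> ('n \<Rightarrow> 'n)\<close>. Only the values at \<open>(i, \<sigma>)\<close> with \<open>i < r\<close> and \<open>\<sigma>\<close> bijective count, as coefficients of
  \<open>\<sigma>\<close> times the \<open>i\<close>-th generator. The remaining values are a redundant summand on which \<open>combine\<close> vanishes;
  it saves working with a subspace as the domain.\<close>

definition fun_scale :: "'k::field \<Rightarrow> ('i \<Rightarrow> 'k) \<Rightarrow> 'i \<Rightarrow> 'k" where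
  "fun_scale c x = (\<lambda>i. c * x i)"

lemma vector_space_fun_scale: "vector_space fun_scale"
  by unfold_locales (simp_all add: fun_scale_def fun_eq_iff algebra_simps)

definition translate :: "('n \<Rightarrow> 'n) \<Rightarrow> (nat \<times> ('n \<Rightarrow> 'n) \<Rightarrow> 'k) \<Rightarrow> nat \<times> ('n \<Rightarrow> 'n) \<Rightarrow> 'k" where
  "translate \<sigma> x = (\<lambda>(i, \<tau>). x (i, inv_into UNIV \<sigma> \<circ> \<tau>))"

definition combine ::
  "nat \<Rightarrow> (nat \<Rightarrow> ('n::finite, 'k::field) mpoly) \<Rightarrow> (nat \<times> ('n \<Rightarrow> 'n) \<Rightarrow> 'k) \<Rightarrow> ('n, 'k) mpoly" where
  "combine r f x = (\<Sum>i<r. \<Sum>\<sigma> | bij \<sigma>. mp_scale (x (i, \<sigma>)) (perm_act \<sigma> (f i)))"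

definition gen_unit :: "nat \<Rightarrow> nat \<times> ('n \<Rightarrow> 'n) \<Rightarrow> 'k::field" where
  "gen_unit i = (\<lambda>(j, \<tau>). if j = i \<and> \<tau> = id then 1 else 0)"

lemma linear_translate: "Vector_Spaces.linear fun_scale fun_scale (translate \<sigma>)"
proof -
  interpret vector_space fun_scale by (rule vector_space_fun_scale)
  show ?thesis by unfold_locales (auto simp: translate_def fun_scale_def fun_eq_iff)
qed

lemma translate_comp:
  "bij \<sigma> \<Longrightarrow> bij \<tau> \<Longrightarrow> translate \<sigma> (translate \<tau> x) = translate (\<sigma> \<circ> \<tau>) x"
  by (auto simp: translate_def fun_eq_iff o_inv_distrib comp_assoc)

lemma linear_combine: "Vector_Spaces.linear fun_scale mp_scale (combine r f)"
proof -
  interpret vector_space_pair fun_scale mp_scale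
    by (simp add: vector_space_pair_def vector_space_fun_scale mp.vector_space_axioms)
  show ?thesis
    by unfold_locales
      (simp_all add: combine_def fun_scale_def mp.scale_left_distrib sum.distrib mp.scale_sum_right)
qed

lemma combine_translate:
  assumes \<sigma>: "bij \<sigma>"
  shows "combine r f (translate \<sigma> x) = perm_act \<sigma> (combine r f x)"
proof -
  interpret \<sigma>: Vector_Spaces.linear mp_scale mp_scale "perm_act \<sigma>" by (rule linear_perm_act[OF \<sigma>])
  have "(\<Sum>\<tau> | bij \<tau>. mp_scale (translate \<sigma> x (i, \<tau>)) (perm_act \<tau> (f i)))
      = (\<Sum>\<tau> | bij \<tau>. mp_scale (translate \<sigma> x (i, \<sigma> \<circ> \<tau>)) (perm_act (\<sigma> \<circ> \<tau>) (f i)))" for i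
    by (rule sum.reindex_bij_betw[OF bij_betw_comp_left[OF \<sigma>], symmetric])
  also have "(\<Sum>\<tau> | bij \<tau>. mp_scale (translate \<sigma> x (i, \<sigma> \<circ> \<tau>)) (perm_act (\<sigma> \<circ> \<tau>) (f i)))
     = (\<Sum>\<tau> | bij \<tau>. perm_act \<sigma> (mp_scale (x (i, \<tau>)) (perm_act \<tau> (f i))))" for i
    using \<sigma> by (intro sum.cong refl)
      (auto simp: translate_def comp_assoc[symmetric] bij_is_inj perm_act_scale perm_act_comp)
  finally show ?thesis by (simp add: combine_def \<sigma>.sum)
qed

lemma sum_fun_apply: "(\<Sum>a\<in>A. h a) p = (\<Sum>a\<in>A. h a p)"
  by (induction A rule: infinite_finite_induct) auto

text \<open>An equivariant map out of a free module is determined by the images of the generators. The assumption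
  \<open>van\<close> makes this true in the presence of the redundant summand.\<close>

lemma combine_unique:
  fixes \<theta> :: "(nat \<times> ('n \<Rightarrow> 'n) \<Rightarrow> 'k::field) \<Rightarrow> ('n::finite, 'k) mpoly"
  assumes lin: "Vector_Spaces.linear fun_scale mp_scale \<theta>"
    and equi: "\<And>\<sigma> x. bij \<sigma> \<Longrightarrow> \<theta> (translate \<sigma> x) = perm_act \<sigma> (\<theta> x)"
    and van: "\<And>x. (\<And>i \<sigma>. i < r \<Longrightarrow> bij \<sigma> \<Longrightarrow> x (i, \<sigma>) = 0) \<Longrightarrow> \<theta> x = 0"
  shows "\<theta> = combine r (\<lambda>i. \<theta> (gen_unit i))"
proof
  fix x :: "nat \<times> ('n \<Rightarrow> 'n) \<Rightarrow> 'k"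
  interpret \<theta>: Vector_Spaces.linear fun_scale mp_scale \<theta> by (rule lin)
  define y where "y = (\<Sum>i<r. \<Sum>\<sigma> | bij \<sigma>. fun_scale (x (i, \<sigma>)) (translate \<sigma> (gen_unit i)))"
  have "(x - y) (j, \<tau>) = 0" if "j < r" "bij \<tau>" for j \<tau>
  proof -
    have "translate \<sigma> (gen_unit i) (j, \<tau>) = (if i = j then if \<sigma> = \<tau> then 1 else 0 else 0 :: 'k)" if "bij \<sigma>" for i \<sigma>
    proof -
      have "inv_into UNIV \<sigma> \<circ> \<tau> = id \<longleftrightarrow> \<sigma> = \<tau>"
        using that \<open>bij \<tau>\<close> by (metis bij_is_inj bij_is_surj comp_assoc comp_id id_comp inv_o_cancel surj_iff)
      then show ?thesis by (auto simp: translate_def gen_unit_def)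
    qed
    note tr = this
    have "x (i, \<sigma>) * translate \<sigma> (gen_unit i) (j, \<tau>) = (if i = j then if \<sigma> = \<tau> then x (i, \<sigma>) else 0 else 0)"
      if "bij \<sigma>" for i \<sigma> by (subst tr[OF that]) simp
    then have "y (j, \<tau>) = (\<Sum>i<r. \<Sum>\<sigma> | bij \<sigma>. if i = j then if \<sigma> = \<tau> then x (i, \<sigma>) else 0 else 0)"
      unfolding y_def sum_fun_apply fun_scale_def by (intro sum.cong refl) (simp del: if_split)
    also have "\<dots> = (\<Sum>i<r. if i = j then x (i, \<tau>) else 0)"
      using that by (intro sum.cong refl) simp
    also have "\<dots> = x (j, \<tau>)" using that by simp
    finally show ?thesis by simp
  qed
  then have "\<theta> (x - y) = 0" by (rule van)
  then have "\<theta> x = \<theta> y" by (simp add: \<theta>.diff)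
  also have "\<theta> y = combine r (\<lambda>i. \<theta> (gen_unit i)) x"
    by (simp add: y_def combine_def \<theta>.sum \<theta>.scale equi)
  finally show "\<theta> x = combine r (\<lambda>i. \<theta> (gen_unit i)) x" .
qed

lemma range_combine: "range (combine r f) = orbit_span (f ` {..<r})"
proof
  interpret c: Vector_Spaces.linear fun_scale mp_scale "combine r f" by (rule linear_combine)
  show "range (combine r f) \<subseteq> orbit_span (f ` {..<r})"
    unfolding orbit_span_def combine_def
    by (rule image_subsetI, intro mp.span_sum mp.span_scale mp.span_base) auto
  have "perm_act \<sigma> (f i) \<in> range (combine r f)" if "i < r" "bij \<sigma>" for i \<sigma>
  proof -
    have "combine r f (\<lambda>(j, \<tau>). if j = i then if \<tau> = \<sigma> then 1 else 0 else 0) =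
      (\<Sum>j<r. if j = i then perm_act \<sigma> (f i) else 0)"
      unfolding combine_def using that
      by (intro sum.cong refl) (auto simp: if_distrib[of "\<lambda>c. mp_scale c _"] cong: if_cong)
    also have "\<dots> = perm_act \<sigma> (f i)" using that by simp
    finally show ?thesis by (metis rangeI)
  qed
  then have "{perm_act \<sigma> g | \<sigma> g. bij \<sigma> \<and> g \<in> f ` {..<r}} \<subseteq> range (combine r f)" by blast
  then show "orbit_span (f ` {..<r}) \<subseteq> range (combine r f)"
    unfolding orbit_span_def by (rule mp.span_minimal) (simp add: c.subspace_image)
qed

text \<open>If there are fewer than \<open>r\<close> generators, the list of generators is filled up with zeros.\<close>

lemma r_generated_iff_combine: "r_generated r M \<longleftrightarrow> (\<exists>f. M = range (combine r f))"
proof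
  assume "r_generated r M"
  then obtain S where S: "finite S" "card S \<le> r" "M = orbit_span S"
    by (auto simp: r_generated_def hull_eq_orbit_span)
  obtain e where e: "bij_betw e {..<card S} S"
    using S(1) ex_bij_betw_nat_finite[of S] by (auto simp: atLeast0LessThan)
  define f where "f i = (if i < card S then e i else 0)" for i
  have "S = f ` {..<card S}" using e by (auto simp: f_def bij_betw_def)
  also have "\<dots> \<subseteq> f ` {..<r}" using S(2) by (intro image_mono) auto
  finally have "S \<subseteq> f ` {..<r}" .
  moreover have "f ` {..<r} \<subseteq> orbit_span S"
    using e orbit_span_superset[of S] mp.subspace_0[OF subspace_orbit_span[of S]]
    by (auto simp: f_def bij_betw_def)
  ultimately have "orbit_span (f ` {..<r}) = orbit_span S" by (rule orbit_span_eqI)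
  then show "\<exists>f. M = range (combine r f)" using S(3) by (auto simp: range_combine)
next
  assume "\<exists>f. M = range (combine r f)"
  then obtain f where "M = orbit_span (f ` {..<r})" by (auto simp: range_combine)
  moreover have "card (f ` {..<r}) \<le> r" using card_image_le[of "{..<r}" f] by simp
  ultimately show "r_generated r M"
    by (auto simp: r_generated_def hull_eq_orbit_span)
qed

text \<open>Let \<open>M\<close> be the image of \<open>\<phi>\<close>. Adding a corner term \<open>\<delta> = (1 - q) \<theta> (1 - p)\<close> to \<open>\<phi>\<close> does not change \<open>\<phi>\<close> on the
  image of \<open>p\<close>, so the image of \<open>\<phi> + \<delta>\<close> contains \<open>M\<close> and by maximality equals it. Then \<open>\<delta>\<close> takes values in
  \<open>M\<close> as well as in the kernel of \<open>q\<close>, hence is zero. This is the hypothesis under which \<open>\<phi>\<close> has the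
  largest possible rank.\<close>

lemma dim_le_of_maximal_r_generated:
  fixes M N :: "('n::finite, 'k::field) mpoly set"
  assumes char: "CHAR('k) = 0 \<or> CHAR('k) > CARD('n)"
    and M: "maximal_r_generated r d M" and N: "r_generated r N" "N \<subseteq> hom_comp d"
  shows "mp.dim N \<le> mp.dim M"
proof -
  interpret V: vector_space_pair 
    "fun_scale :: 'k \<Rightarrow> (nat \<times> ('n \<Rightarrow> 'n) \<Rightarrow> 'k) \<Rightarrow> _" "mp_scale :: 'k \<Rightarrow> ('n, 'k) mpoly \<Rightarrow> _"
    by (simp add: vector_space_pair_def vector_space_fun_scale mp.vector_space_axioms)
  \<comment> \<open>The elements of the redundant summand of the free module.\<close>
  define null :: "(nat \<times> ('n \<Rightarrow> 'n) \<Rightarrow> 'k) \<Rightarrow> bool"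
    where "null x \<longleftrightarrow> (\<forall>i<r. \<forall>\<sigma>. bij \<sigma> \<longrightarrow> x (i, \<sigma>) = 0)" for x
  define H :: "((nat \<times> ('n \<Rightarrow> 'n) \<Rightarrow> 'k) \<Rightarrow> ('n, 'k) mpoly) set"
    where "H = {\<theta>. Vector_Spaces.linear fun_scale mp_scale \<theta> \<and>
        (\<forall>\<sigma> x. bij \<sigma> \<longrightarrow> \<theta> (translate \<sigma> x) = perm_act \<sigma> (\<theta> x)) \<and>
        (\<forall>x. null x \<longrightarrow> \<theta> x = 0) \<and> range \<theta> \<subseteq> hom_comp d}"
  define E :: "((nat \<times> ('n \<Rightarrow> 'n) \<Rightarrow> 'k) \<Rightarrow> nat \<times> ('n \<Rightarrow> 'n) \<Rightarrow> 'k) set"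
    where "E = {a. Vector_Spaces.linear fun_scale fun_scale a \<and>
        (\<forall>\<sigma> x. bij \<sigma> \<longrightarrow> a (translate \<sigma> x) = translate \<sigma> (a x)) \<and>
        (\<forall>x. null x \<longrightarrow> null (a x))}"
  have combine_H: "combine r f \<in> H" if "range (combine r f) \<subseteq> hom_comp d" for f
  proof -
    have "combine r f x = 0" if "null x" for x
      using that by (auto simp: combine_def null_def intro!: sum.neutral)
    then show ?thesis using that by (auto simp: H_def linear_combine combine_translate)
  qed
  have H_generated: "r_generated r (range \<theta>)" if "\<theta> \<in> H" for \<theta>
  proof -
    have "\<theta> = combine r (\<lambda>i. \<theta> (gen_unit i))"
      using that by (intro combine_unique) (auto simp: H_def null_def)
    then have "range \<theta> = range (combine r (\<lambda>i. \<theta> (gen_unit i)))" by (rule arg_cong)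
    then show ?thesis unfolding r_generated_iff_combine by blast
  qed
  obtain f g where f: "M = range (combine r f)" and g: "N = range (combine r g)"
    using M N by (auto simp: maximal_r_generated_def r_generated_iff_combine)
  define \<phi> where "\<phi> = combine r f"
  have \<phi>: "\<phi> \<in> H" "range \<phi> = M" using M f combine_H by (auto simp: \<phi>_def maximal_r_generated_def)
  have \<theta>: "combine r g \<in> H" using N g combine_H by auto
  obtain s where s: "Vector_Spaces.linear mp_scale fun_scale s"
     "\<And>\<sigma> y. bij \<sigma> \<Longrightarrow> s (perm_act \<sigma> y) = translate \<sigma> (s y)" "\<And>x. \<phi> (s (\<phi> x)) = \<phi> x"
    by (rule V.equivariant_quasi_inverse[OF of_nat_card_bij_neq_0[OF char], of \<phi> translate perm_act])
      (use \<phi>(1) in \<open>auto simp: H_def linear_translate linear_perm_act translate_comp perm_act_comp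
        simp del: id_apply\<close>)
  interpret s: Vector_Spaces.linear mp_scale fun_scale s by (rule s(1))
  interpret \<phi>: Vector_Spaces.linear fun_scale mp_scale \<phi> using \<phi>(1) by (simp add: H_def)
  have corner: "\<phi> (s (\<theta> (x - s (\<phi> x)))) = \<theta> (x - s (\<phi> x))" if \<theta>: "\<theta> \<in> H" for \<theta> x
  proof -
    interpret \<theta>: Vector_Spaces.linear fun_scale mp_scale \<theta> using \<theta> by (simp add: H_def)
    define \<delta> where "\<delta> x = \<theta> (x - s (\<phi> x)) - \<phi> (s (\<theta> (x - s (\<phi> x))))" for x
    have \<phi>\<delta>: "\<phi> (s (\<delta> x)) = 0" for x by (simp add: \<delta>_def s.diff \<phi>.diff s(3))
    have \<phi>equi: "\<phi> (translate \<sigma> x) = perm_act \<sigma> (\<phi> x)" and \<theta>equi: "\<theta> (translate \<sigma> x) = perm_act \<sigma> (\<theta> x)"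
      if "bij \<sigma>" for \<sigma> x using that \<phi>(1) \<theta> by (auto simp: H_def)
    have \<phi>null: "\<phi> x = 0" and \<theta>null: "\<theta> x = 0" if "null x" for x
      using that \<phi>(1) \<theta> by (auto simp: H_def)
    have \<phi>hom: "\<phi> x \<in> hom_comp d" and \<theta>hom: "\<theta> x \<in> hom_comp d" for x
      using \<phi>(1) \<theta> by (auto simp: H_def)
    have "Vector_Spaces.linear fun_scale mp_scale (\<lambda>x. \<phi> x + \<delta> x)"
      by unfold_locales (simp_all add: \<delta>_def \<phi>.add \<phi>.diff \<phi>.scale \<theta>.add \<theta>.diff \<theta>.scale
          s.add s.diff s.scale mp.scale_right_distrib mp.scale_right_diff_distrib)
    moreover have "\<phi> (translate \<sigma> x) + \<delta> (translate \<sigma> x) = perm_act \<sigma> (\<phi> x + \<delta> x)"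
      if \<sigma>: "bij \<sigma>" for \<sigma> x
    proof -
      interpret \<sigma>: Vector_Spaces.linear mp_scale mp_scale "perm_act \<sigma>" by (rule linear_perm_act[OF \<sigma>])
      show ?thesis
        using \<sigma> by (simp add: \<delta>_def \<phi>.diff \<theta>.diff s.diff \<phi>equi \<theta>equi s(2) \<sigma>.add \<sigma>.diff)
    qed
    moreover have "\<phi> x + \<delta> x = 0" if "null x" for x
      using that by (simp add: \<delta>_def \<phi>null \<theta>null s.zero \<phi>.zero)
    moreover have "\<phi> x + \<delta> x \<in> hom_comp d" for x
      unfolding \<delta>_def
      by (intro mp.subspace_add mp.subspace_diff subspace_hom_comp \<phi>hom \<theta>hom)
    ultimately have "(\<lambda>x. \<phi> x + \<delta> x) \<in> H" by (auto simp: H_def)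
    then have "r_generated r (range (\<lambda>x. \<phi> x + \<delta> x))" "range (\<lambda>x. \<phi> x + \<delta> x) \<subseteq> hom_comp d"
      using H_generated by (auto simp: H_def)
    moreover have "M \<subseteq> range (\<lambda>x. \<phi> x + \<delta> x)"
    proof -
      have eq: "\<phi> x = \<phi> (s (\<phi> x)) + \<delta> (s (\<phi> x))" for x
        by (simp add: \<delta>_def s(3) \<theta>.zero s.zero \<phi>.zero)
      have "\<phi> x \<in> range (\<lambda>x. \<phi> x + \<delta> x)" for x
        by (rule range_eqI[of "\<phi> x" "\<lambda>x. \<phi> x + \<delta> x" "s (\<phi> x)", OF eq])
      then show ?thesis unfolding \<phi>(2)[symmetric] by blast
    qed
    ultimately have "range (\<lambda>x. \<phi> x + \<delta> x) = M"
      using M by (simp add: maximal_r_generated_def)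
    then have "range (\<lambda>x. \<phi> x + \<delta> x) = range \<phi>" using \<phi>(2) by simp
    from eq_refl[OF this] have "\<phi> x + \<delta> x \<in> range \<phi>" by (rule subsetD) (rule rangeI)
    then obtain z where "\<phi> x + \<delta> x = \<phi> z" by blast
    then have "\<delta> x = \<phi> (z - x)" by (simp add: \<phi>.diff algebra_simps)
    then have "\<delta> x = 0" using \<phi>\<delta>[of x] s(3) by simp
    then show ?thesis by (simp add: \<delta>_def)
  qed
  obtain F :: "('n, 'k) mpoly set" where F: "finite F" "hom_comp d \<subseteq> mp.span F" by (rule hom_comp_finitely_spanned)
  have "mp.dim (range (combine r g)) \<le> mp.dim (range \<phi>)"
  proof (rule V.dim_range_le_of_quasi_inverse[where H = H and E = E and s = s and F = F])
    show "id \<in> E" using V.vs1.linear_id by (simp add: E_def)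
    show "s \<circ> \<eta> \<in> E" if "\<eta> \<in> H" for \<eta>
      using that s(1,2) by (auto simp: H_def E_def null_def s.zero intro: Vector_Spaces.linear_compose)
    show "\<eta> \<circ> a \<in> H" if "\<eta> \<in> H" "a \<in> E" for \<eta> a
      using that by (auto simp: H_def E_def intro: Vector_Spaces.linear_compose)
    show "range \<phi> \<subseteq> mp.span F" using \<phi>(1) F by (auto simp: H_def)
  qed (use \<phi> \<theta> F(1) corner s.zero in \<open>auto simp: H_def\<close>)
  then show ?thesis using g \<phi>(2) by simp
qed

section \<open>Independence and nonvanishing minors\<close>

lemma (in vector_space) independent_list_iff:
  "distinct ws \<and> independent (set ws) \<longleftrightarrow>
    (\<forall>c. (\<Sum>i<length ws. scale (c i) (ws ! i)) = 0 \<longrightarrow> (\<forall>i<length ws. c i = 0))"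
proof (intro iffI conjI allI impI)
  fix c i
  assume ind: "distinct ws \<and> independent (set ws)"
    and zero: "(\<Sum>i<length ws. scale (c i) (ws ! i)) = 0" and i: "i < length ws"
  have bij: "bij_betw ((!) ws) {..<length ws} (set ws)"
    using ind by (intro bij_betw_nth) auto
  define u where "u w = c (the_inv_into {..<length ws} ((!) ws) w)" for w
  have u: "u (ws ! j) = c j" if "j < length ws" for j
    using that bij by (simp add: u_def the_inv_into_f_f bij_betw_def)
  have "(\<Sum>w\<in>set ws. scale (u w) w) = (\<Sum>j<length ws. scale (u (ws ! j)) (ws ! j))"
    by (rule sum.reindex_bij_betw[OF bij, symmetric])
  also have "\<dots> = 0" using zero by (simp add: u)
  finally have "u (ws ! i) = 0"
    using ind i independentD[of "set ws" "set ws" u "ws ! i"] by simp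
  then show "c i = 0" using u[OF i] by simp
next
  assume *: "\<forall>c. (\<Sum>i<length ws. scale (c i) (ws ! i)) = 0 \<longrightarrow> (\<forall>i<length ws. c i = 0)"
  show dist: "distinct ws"
  proof (rule ccontr)
    assume "\<not> distinct ws"
    then obtain i j where ij: "i < length ws" "j < length ws" "i \<noteq> j" "ws ! i = ws ! j"
      by (auto simp: distinct_conv_nth)
    define c where "c l = (if l = i then 1 else 0) - (if l = j then 1 else (0 :: 'a))" for l
    have "(\<Sum>l<length ws. scale (c l) (ws ! l)) =
        (\<Sum>l<length ws. if l = i then ws ! i else 0) - (\<Sum>l<length ws. if l = j then ws ! j else 0)"
      unfolding sum_subtractf[symmetric] by (intro sum.cong) (auto simp: c_def)
    also have "\<dots> = 0" using ij by simp
    finally have "c i = 0" using * ij(1) by blast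
    then show False using ij(3) by (simp add: c_def)
  qed
  show "independent (set ws)"
  proof (rule independent_if_scalars_zero)
    fix u w assume u: "(\<Sum>w\<in>set ws. scale (u w) w) = 0" and w: "w \<in> set ws"
    have "(\<Sum>w\<in>set ws. scale (u w) w) = (\<Sum>j<length ws. scale (u (ws ! j)) (ws ! j))"
      by (rule sum.reindex_bij_betw[OF bij_betw_nth, symmetric]) (use dist in auto)
    then have "\<forall>i<length ws. u (ws ! i) = 0" using *[THEN spec, of "\<lambda>i. u (ws ! i)"] u by simp
    then show "u w = 0" using w by (auto simp: in_set_conv_nth)
  qed simp
qed

text \<open>Laplace expansion along column \<open>i\<close>: the cofactors of that column do not depend on its entries, so the
  coordinate is a linear function of the replaced column. Both the existence of a nonzero minor and
  Cramer's rule below rest on this.\<close>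

lemma plucker_coord_update:
  assumes i: "i < length vs" and len: "length J = length vs"
  shows "plucker_coord vs (J[i := m]) = (\<Sum>l<length vs. Poly_Mapping.lookup (vs ! l) m *
      cofactor (mat (length vs) (length vs) (\<lambda>(a, b). Poly_Mapping.lookup (vs ! a) (J ! b))) l i)"
proof -
  define A where "A J = mat (length vs) (length vs) (\<lambda>(a, b). Poly_Mapping.lookup (vs ! a) (J ! b))"
    for J :: "'a mon list"
  have "mat_delete (A (J[i := m])) l i = mat_delete (A J) l i" for l
    by (rule eq_matI) (auto simp: A_def mat_delete_def)
  then have "cofactor (A (J[i := m])) l i = cofactor (A J) l i" for l
    by (simp add: cofactor_def)
  moreover have "det (A (J[i := m])) =
      (\<Sum>l<length vs. A (J[i := m]) $$ (l, i) * cofactor (A (J[i := m])) l i)"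
    by (rule laplace_expansion_column) (use i in \<open>auto simp: A_def\<close>)
  ultimately show ?thesis
    using i len by (simp add: plucker_coord_def A_def)
qed

lemma independent_of_plucker_coord:
  assumes "plucker_coord vs ms \<noteq> 0"
  shows "distinct vs \<and> mp.independent (set vs)"
  unfolding mp.independent_list_iff
proof (intro allI impI)
  fix c i
  assume zero: "(\<Sum>i<length vs. mp_scale (c i) (vs ! i)) = 0" and i: "i < length vs"
  define A where "A = mat (length vs) (length vs) (\<lambda>(a, b). Poly_Mapping.lookup (vs ! a) (ms ! b))"
  have A: "A \<in> carrier_mat (length vs) (length vs)" by (simp add: A_def)
  have "det A\<^sup>T \<noteq> 0" using assms det_transpose[OF A] by (simp add: plucker_coord_def A_def)
  moreover have "A\<^sup>T *\<^sub>v vec (length vs) c = 0\<^sub>v (length vs)"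
  proof (rule eq_vecI)
    fix j assume "j < dim_vec (0\<^sub>v (length vs))"
    then have "(A\<^sup>T *\<^sub>v vec (length vs) c) $ j = (\<Sum>i<length vs. Poly_Mapping.lookup (vs ! i) (ms ! j) * c i)"
      by (simp add: A_def scalar_prod_def atLeast0LessThan)
    also have "\<dots> = Poly_Mapping.lookup (\<Sum>i<length vs. mp_scale (c i) (vs ! i)) (ms ! j)"
      by (simp add: lookup_sum mult.commute)
    finally show "(A\<^sup>T *\<^sub>v vec (length vs) c) $ j = 0\<^sub>v (length vs) $ j"
      using \<open>j < _\<close> zero by simp
  qed (simp add: A_def)
  ultimately have "vec (length vs) c = 0\<^sub>v (length vs)"
    using det_0_iff_vec_prod_zero_field[of "A\<^sup>T" "length vs"] A
    by (metis transpose_carrier_mat vec_carrier)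
  then have "vec (length vs) c $ i = 0\<^sub>v (length vs) $ i" by simp
  then show "c i = 0" using i by simp
qed

text \<open>Induction on the number of vectors. Given columns \<open>ms\<close> with a nonzero minor for \<open>vs\<close>, suppose that adding
  any further column \<open>m\<close> gives zero for \<open>vs @ [v]\<close>. Expanding along the last column yields the same linear
  relation between the vectors for every \<open>m\<close>, and the coefficient of \<open>v\<close> in it is the nonzero minor.\<close>

lemma plucker_coord_nonzero_exists:
  assumes "distinct vs" "mp.independent (set vs)" "\<And>v. v \<in> set vs \<Longrightarrow> Poly_Mapping.keys v \<subseteq> S"
  shows "\<exists>ms. length ms = length vs \<and> set ms \<subseteq> S \<and> plucker_coord vs ms \<noteq> 0"
  using assms
proof (induction vs rule: rev_induct)
  case Nil
  show ?case by (simp add: plucker_coord_def)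
next
  case (snoc v vs)
  have "mp.independent (set vs)" using snoc.prems(2) by (rule mp.independent_mono) auto
  then obtain ms where ms: "length ms = length vs" "set ms \<subseteq> S" "plucker_coord vs ms \<noteq> 0"
    using snoc.IH snoc.prems by auto
  define n where "n = length vs"
  define c where "c l = cofactor (mat (Suc n) (Suc n)
    (\<lambda>(a, b). Poly_Mapping.lookup ((vs @ [v]) ! a) ((ms @ [0]) ! b))) l n" for l
  have expand: "plucker_coord (vs @ [v]) (ms @ [m]) = (\<Sum>l<Suc n. Poly_Mapping.lookup ((vs @ [v]) ! l) m * c l)" for m
  proof -
    have "(ms @ [0])[n := m] = ms @ [m]" using ms(1) by (simp add: list_update_append n_def)
    then show ?thesis
      using plucker_coord_update[of n "vs @ [v]" "ms @ [0]" m] ms(1)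
      by (simp add: n_def c_def del: sum.lessThan_Suc)
  qed
  have "mat_delete (mat (Suc n) (Suc n) (\<lambda>(a, b). Poly_Mapping.lookup ((vs @ [v]) ! a) ((ms @ [0]) ! b))) n n
      = mat n n (\<lambda>(a, b). Poly_Mapping.lookup (vs ! a) (ms ! b))"
    using ms(1) by (intro eq_matI) (auto simp: mat_delete_def nth_append n_def)
  then have "c n = plucker_coord vs ms"
    by (simp add: c_def cofactor_def plucker_coord_def n_def)
  then have cn: "c n \<noteq> 0" using ms(3) by simp
  have "\<exists>m\<in>S. plucker_coord (vs @ [v]) (ms @ [m]) \<noteq> 0"
  proof (rule ccontr)
    assume neg: "\<not> ?thesis"
    have "(\<Sum>l<Suc n. Poly_Mapping.lookup ((vs @ [v]) ! l) m * c l) = 0" for m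
    proof (cases "m \<in> S")
      case True
      then show ?thesis using neg expand by metis
    next
      case False
      have "Poly_Mapping.lookup ((vs @ [v]) ! l) m = 0" if "l < Suc n" for l
      proof -
        have "(vs @ [v]) ! l \<in> set (vs @ [v])" using that by (intro nth_mem) (simp add: n_def)
        then have "Poly_Mapping.keys ((vs @ [v]) ! l) \<subseteq> S" by (rule snoc.prems(3))
        then show ?thesis using False by (auto simp: in_keys_iff)
      qed
      then show ?thesis by (intro sum.neutral) simp
    qed
    then have "(\<Sum>l<length (vs @ [v]). mp_scale (c l) ((vs @ [v]) ! l)) = 0"
      by (intro poly_mapping_eqI) (simp add: lookup_sum lookup_add n_def mult.commute)
    moreover have "\<forall>c. (\<Sum>l<length (vs @ [v]). mp_scale (c l) ((vs @ [v]) ! l)) = 0 \<longrightarrow>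
        (\<forall>l<length (vs @ [v]). c l = 0)"
      using snoc.prems(1,2) by (intro mp.independent_list_iff[THEN iffD1]) simp
    ultimately have "c n = 0" by (simp add: n_def)
    then show False using cn by simp
  qed
  then obtain m where "m \<in> S" "plucker_coord (vs @ [v]) (ms @ [m]) \<noteq> 0" by blast
  then show ?case using ms by (intro exI[of _ "ms @ [m]"]) simp
qed

section \<open>Bases whose coefficients are Pluecker coordinates\<close>

text \<open>The combination of \<open>vs\<close> with the cofactors of column \<open>i\<close> of the minor \<open>J\<close>. It is defined for arbitrary \<open>J\<close>,
  also when the minor vanishes.\<close>

definition cramer_vector :: "('n, 'k::field) mpoly list \<Rightarrow> 'n mon list \<Rightarrow> nat \<Rightarrow> ('n, 'k) mpoly" where
  "cramer_vector vs J i = (\<Sum>l<length vs. mp_scale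
     (cofactor (mat (length vs) (length vs) (\<lambda>(a, b). Poly_Mapping.lookup (vs ! a) (J ! b))) l i) (vs ! l))"

lemma lookup_cramer_vector:
  "i < length vs \<Longrightarrow> length J = length vs \<Longrightarrow>
    Poly_Mapping.lookup (cramer_vector vs J i) m = plucker_coord vs (J[i := m])"
  by (simp add: cramer_vector_def lookup_sum plucker_coord_update mult.commute)

lemma cramer_vector_in_span: "cramer_vector vs J i \<in> mp.span (set vs)"
  unfolding cramer_vector_def by (intro mp.span_sum mp.span_scale mp.span_base) auto

text \<open>Restricted to the columns \<open>J\<close>, the coefficient matrix of these vectors is the minor times the identity
  matrix: replacing column \<open>i\<close> by column \<open>j \<noteq> i\<close> produces two equal columns. Thus they are independent, and
  there are as many of them as there are vectors in \<open>vs\<close>.\<close>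

lemma span_cramer_vectors:
  assumes len: "length J = length vs" and J: "plucker_coord vs J \<noteq> 0"
  shows "mp.span (cramer_vector vs J ` {..<length vs}) = mp.span (set vs)"
proof -
  define n where "n = length vs"
  define gs where "gs = map (cramer_vector vs J) [0..<n]"
  have entry: "plucker_coord vs (J[i := J ! j]) = (if i = j then plucker_coord vs J else 0)"
    if "i < n" "j < n" for i j
  proof (cases "i = j")
    case False
    have "plucker_coord vs (J[i := J ! j]) = 0" unfolding plucker_coord_def
      by (rule det_identical_columns[OF _ False]) (use that len False in \<open>auto simp: n_def\<close>)
    then show ?thesis using False by simp
  qed simp
  have lgs: "length gs = n" by (simp add: gs_def)
  have "mat n n (\<lambda>(i, j). Poly_Mapping.lookup (gs ! i) (J ! j)) = plucker_coord vs J \<cdot>\<^sub>m 1\<^sub>m n"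
    by (rule eq_matI) (auto simp: gs_def lookup_cramer_vector entry len n_def)
  then have "plucker_coord gs J = plucker_coord vs J ^ n"
    by (simp add: plucker_coord_def[of gs] lgs)
  then have "plucker_coord gs J \<noteq> 0" using J by simp
  then have gs: "distinct gs" "mp.independent (set gs)" using independent_of_plucker_coord by auto
  have vs: "distinct vs" "mp.independent (set vs)" using independent_of_plucker_coord[OF J] by auto
  have "mp.span (set gs) = mp.span (set vs)"
  proof (rule mp.subspace_eq_finitely_spanned)
    show "mp.span (set gs) \<subseteq> mp.span (set vs)"
      by (intro mp.span_minimal) (auto simp: gs_def cramer_vector_in_span)
    show "mp.dim (mp.span (set vs)) \<le> mp.dim (mp.span (set gs))"
      unfolding mp.dim_span_eq_card_independent[OF vs(2)] mp.dim_span_eq_card_independent[OF gs(2)]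
        distinct_card[OF vs(1)] distinct_card[OF gs(1)] lgs n_def by simp
  qed auto
  then show ?thesis by (simp add: gs_def n_def atLeast0LessThan)
qed

section \<open>Evaluation of determinants of variables\<close>

text \<open>Evaluation without change of coefficients is a ring homomorphism, so it commutes with determinants.
  The coefficient map is written \<open>\<lambda>c. c\<close>, the form to which the simplifier brings \<open>id\<close>.\<close>

lemma mp_eval_add:
  fixes x :: "'v \<Rightarrow> 'k::comm_ring_1"
  shows "mp_eval (\<lambda>c. c) x (f + g) = mp_eval (\<lambda>c. c) x f + mp_eval (\<lambda>c. c) x g"
proof -
  let ?S = "Poly_Mapping.keys f \<union> Poly_Mapping.keys g"
  have *: "mp_eval (\<lambda>c. c) x h = (\<Sum>m\<in>?S. Poly_Mapping.lookup h m * (\<Prod>i\<in>Poly_Mapping.keys m. x i ^ Poly_Mapping.lookup m i))"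
    if "Poly_Mapping.keys h \<subseteq> ?S" for h
    unfolding mp_eval_def using that
    by (intro sum.mono_neutral_left) (auto simp: in_keys_iff)
  show ?thesis
    unfolding *[OF Poly_Mapping.keys_add] *[of f, OF Un_upper1] *[of g, OF Un_upper2]
    by (simp add: lookup_add distrib_right sum.distrib)
qed

lemma mp_eval_single:
  fixes x :: "'v \<Rightarrow> 'k::comm_ring_1"
  shows "mp_eval (\<lambda>c. c) x (Poly_Mapping.single m c) =
    c * (\<Prod>i\<in>Poly_Mapping.keys m. x i ^ Poly_Mapping.lookup m i)"
  by (cases "c = 0") (simp_all add: mp_eval_def)

lemma prod_power_add:
  fixes x :: "'v \<Rightarrow> 'k::comm_ring_1"
  shows "(\<Prod>i\<in>Poly_Mapping.keys (m + m'). x i ^ Poly_Mapping.lookup (m + m') i) =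
    (\<Prod>i\<in>Poly_Mapping.keys m. x i ^ Poly_Mapping.lookup m i) *
    (\<Prod>i\<in>Poly_Mapping.keys m'. x i ^ Poly_Mapping.lookup m' i)"
proof -
  let ?S = "Poly_Mapping.keys m \<union> Poly_Mapping.keys m'"
  have *: "(\<Prod>i\<in>Poly_Mapping.keys h. x i ^ Poly_Mapping.lookup h i) = (\<Prod>i\<in>?S. x i ^ Poly_Mapping.lookup h i)"
    if "Poly_Mapping.keys h \<subseteq> ?S" for h :: "'v mon"
    using that by (intro prod.mono_neutral_left) (auto simp: in_keys_iff)
  show ?thesis
    unfolding *[OF Poly_Mapping.keys_add] *[of m, OF Un_upper1] *[of m', OF Un_upper2]
    by (simp add: lookup_add power_add prod.distrib)
qed

lemma mp_eval_mult:
  fixes x :: "'v \<Rightarrow> 'k::comm_ring_1"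
  shows "mp_eval (\<lambda>c. c) x (f * g) = mp_eval (\<lambda>c. c) x f * mp_eval (\<lambda>c. c) x g"
proof (induction f rule: poly_mapping_induct_single)
  case (add m c f)
  have "mp_eval (\<lambda>c. c) x (Poly_Mapping.single m c * g) = mp_eval (\<lambda>c. c) x (Poly_Mapping.single m c) * mp_eval (\<lambda>c. c) x g"
    by (induction g rule: poly_mapping_induct_single)
      (simp_all add: mult_single distrib_left mp_eval_add mp_eval_single prod_power_add mp_eval_def[of _ _ 0])
  then show ?case using add by (simp add: distrib_right mp_eval_add)
qed (simp add: mp_eval_def)

lemma comm_ring_hom_mp_eval: "comm_ring_hom (mp_eval (\<lambda>c. c) (x :: 'v \<Rightarrow> 'k::comm_ring_1))"
proof
  show "mp_eval (\<lambda>c. c) x 1 = 1"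
    using mp_eval_single[of x 0 1] by simp
qed (simp_all add: mp_eval_add mp_eval_mult mp_eval_def[of _ _ 0])

lemma mp_eval_Var: "mp_eval (\<lambda>c. c) x (Var i) = (x i :: 'k::comm_ring_1)"
  by (simp add: Var_def mp_eval_single)

text \<open>The forms of degree \<open>e\<close> that involve only the variables in \<open>I\<close>. The two conditions on an equation
  of a closed subset of the Grassmannian are treated together.\<close>

definition form_in :: "'v set \<Rightarrow> nat \<Rightarrow> ('v, 'k::comm_ring_1) mpoly set" where
  "form_in I e = {f. f \<in> hom_comp e \<and> (\<forall>m\<in>Poly_Mapping.keys f. Poly_Mapping.keys m \<subseteq> I)}"

lemma form_in_iff: "f \<in> form_in I e \<longleftrightarrow>
   (\<forall>m. Poly_Mapping.lookup f m \<noteq> 0 \<longrightarrow> mon_deg m = e \<and> Poly_Mapping.keys m \<subseteq> I)"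
  by (auto simp: form_in_def hom_comp_def in_keys_iff)

lemma form_in_add: "f \<in> form_in I e \<Longrightarrow> g \<in> form_in I e \<Longrightarrow> f + g \<in> form_in I e"
  unfolding form_in_iff lookup_add by (metis add.right_neutral)

lemma form_in_sum: "(\<And>a. a \<in> A \<Longrightarrow> h a \<in> form_in I e) \<Longrightarrow> sum h A \<in> form_in I e"
  by (induction A rule: infinite_finite_induct) (simp_all add: form_in_add, simp_all add: form_in_iff)

lemma form_in_sign: "f \<in> form_in I e \<Longrightarrow> of_int (sign p) * f \<in> form_in I e"
proof -
  assume f: "f \<in> form_in I e"
  then have "- f \<in> form_in I e" by (simp add: form_in_iff)
  with f show ?thesis by (cases "evenperm p") (simp_all add: sign_def)
qed

lemma form_in_mult:
  assumes "f \<in> form_in I a" "g \<in> form_in I b"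
  shows "f * g \<in> form_in I (a + b)"
proof -
  have "mon_deg m = a + b \<and> Poly_Mapping.keys m \<subseteq> I" if m: "m \<in> Poly_Mapping.keys (f * g)" for m
  proof -
    obtain u v where uv: "m = u + v" "u \<in> Poly_Mapping.keys f" "v \<in> Poly_Mapping.keys g"
      using m Poly_Mapping.keys_mult[of f g] by auto
    then have "mon_deg u = a" "mon_deg v = b" "Poly_Mapping.keys u \<subseteq> I" "Poly_Mapping.keys v \<subseteq> I"
      using assms by (auto simp: form_in_def hom_comp_def)
    then show ?thesis using uv(1) Poly_Mapping.keys_add[of u v] by (auto simp: mon_deg_add)
  qed
  then show ?thesis by (auto simp: form_in_def hom_comp_def)
qed

lemma form_in_prod:
  fixes h :: "'a \<Rightarrow> ('v, 'k::comm_ring_1) mpoly"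
  shows "finite A \<Longrightarrow> (\<And>a. a \<in> A \<Longrightarrow> h a \<in> form_in I 1) \<Longrightarrow> prod h A \<in> form_in I (card A)"
proof (induction A rule: finite_induct)
  case empty
  have "(1 :: ('v, 'k) mpoly) \<in> form_in I 0" 
    by (auto simp: form_in_def hom_comp_def mon_deg_def)
  then show ?case by simp
next
  case (insert a A)
  then show ?case using form_in_mult[of "h a" I 1 "prod h A" "card A"] by simp
qed

lemma Var_form_in: "i \<in> I \<Longrightarrow> Var i \<in> form_in I 1"
  by (auto simp: form_in_def hom_comp_def Var_def mon_deg_def)

lemma det_form_in:
  assumes "\<And>a b. a < n \<Longrightarrow> b < n \<Longrightarrow> h a b \<in> form_in I 1"
  shows "det (mat n n (\<lambda>(a, b). h a b)) \<in> form_in I n"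
proof -
  have "(\<Prod>i = 0..<n. mat n n (\<lambda>(a, b). h a b) $$ (i, p i)) \<in> form_in I (card {0..<n})"
    if "p permutes {0..<n}" for p
  proof (rule form_in_prod)
    fix i assume "i \<in> {0..<n}"
    then have "i < n" "p i < n" using permutes_in_image[OF that, of i] by simp_all
    then show "mat n n (\<lambda>(a, b). h a b) $$ (i, p i) \<in> form_in I 1" using assms by simp
  qed simp
  then show ?thesis
    by (subst det_def'[of _ n], simp, intro form_in_sum form_in_sign) simp
qed

section \<open>The locus where the orbit span has small dimension\<close>

text \<open>Evaluated at the Pluecker coordinates of \<open>vs\<close>, this is the minor with columns \<open>cs\<close> of the
  vectors \<open>\<sigma> g\<^sub>i\<close> for the entries \<open>(\<sigma>, i)\<close> of \<open>rs\<close>, where \<open>g\<^sub>i\<close> is the \<open>i\<close>-th Cramer vector of \<open>J\<close>: the action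
  of \<open>\<sigma>\<close> pulls the monomial back along \<open>\<sigma>\<close>, and the coefficient of \<open>g\<^sub>i\<close> at a monomial \<open>m\<close> is the
  coordinate of \<open>J[i := m]\<close>.\<close>

definition minor_form ::
  "'n mon list \<Rightarrow> (('n \<Rightarrow> 'n) \<times> nat) list \<Rightarrow> 'n mon list \<Rightarrow> ('n mon list, 'k::comm_ring_1) mpoly" where
  "minor_form J rs cs = det (mat (length rs) (length rs) (\<lambda>(a, b).
     Var (J[snd (rs ! a) := Poly_Mapping.map_key (fst (rs ! a)) (cs ! b)])))"

lemma minor_form_in:
  fixes J :: "'n::finite mon list"
  assumes "J \<in> plucker_index r d" "\<And>\<sigma> i. (\<sigma>, i) \<in> set rs \<Longrightarrow> bij \<sigma>"
    and "length cs = length rs" "\<And>m. m \<in> set cs \<Longrightarrow> mon_deg m = d"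
  shows "minor_form J rs cs \<in> form_in (plucker_index r d) (length rs)"
  unfolding minor_form_def
proof (intro det_form_in Var_form_in)
  fix a b assume ab: "a < length rs" "b < length rs"
  then have "bij (fst (rs ! a))" using assms(2)[of "fst (rs ! a)" "snd (rs ! a)"] by simp
  moreover have "mon_deg (cs ! b) = d" using assms(3,4) ab by simp
  ultimately show "J[snd (rs ! a) := Poly_Mapping.map_key (fst (rs ! a)) (cs ! b)] \<in> plucker_index r d"
    using assms(1) by (auto simp: plucker_index_def mon_deg_map_key dest!: set_update_subset_insert[THEN subsetD])
qed

lemma mp_eval_minor_form:
  fixes vs :: "('n::finite, 'k::field) mpoly list"
  assumes len: "length J = length vs" and cs: "length cs = length rs"
    and rs: "\<And>\<sigma> i. (\<sigma>, i) \<in> set rs \<Longrightarrow> bij \<sigma> \<and> i < length vs"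
  shows "mp_eval (\<lambda>c. c) (plucker_coord vs) (minor_form J rs cs) =
    plucker_coord (map (\<lambda>(\<sigma>, i). perm_act \<sigma> (cramer_vector vs J i)) rs) cs"
proof -
  interpret comm_ring_hom "mp_eval (\<lambda>c. c) (plucker_coord vs)" by (rule comm_ring_hom_mp_eval)
  show ?thesis
    unfolding minor_form_def hom_det[symmetric] plucker_coord_def[of "map _ _"]
  proof (rule arg_cong[of _ _ det], rule eq_matI, goal_cases)
    case (1 a b)
    then have ab: "a < length rs" "b < length rs" by simp_all
    obtain \<sigma> i where \<sigma>: "rs ! a = (\<sigma>, i)" by force
    then have "bij \<sigma>" "i < length vs" using rs nth_mem[OF ab(1)] by auto
    then show ?case using ab \<sigma> cs
      by (simp add: mp_eval_Var lookup_perm_act lookup_cramer_vector len)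
  qed simp_all
qed

lemma Gr_ordered_basis:
  assumes "L \<in> Gr r d"
  obtains vs where "ordered_basis L vs" 
proof -
  have L: "mp.subspace L" "L \<subseteq> hom_comp d" using assms by (auto simp: Gr_def)
  obtain F :: "('a, 'b) mpoly set" where F: "finite F" "hom_comp d \<subseteq> mp.span F" by (rule hom_comp_finitely_spanned)
  obtain B where B: "B \<subseteq> L" "mp.independent B" "L \<subseteq> mp.span B" by (rule mp.basis_exists)
  have "finite B" using mp.independent_span_bound[OF F(1) B(2)] B(1) L(2) F(2) by blast
  then obtain vs where "set vs = B" "distinct vs" using finite_distinct_list by blast
  then have "ordered_basis L vs" using B L(1) by (simp add: ordered_basis_def mp.span_subspace)
  then show thesis by (rule that)
qed

lemma ordered_basis_length: "ordered_basis L vs \<Longrightarrow> mp.dim L = length vs"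
  by (auto simp: ordered_basis_def mp.dim_span_eq_card_independent distinct_card simp del: mp.dim_span)

text \<open>If one of the minors is nonzero, its \<open>D\<close> rows are independent elements of \<open>orbit_span L\<close>, whatever
  \<open>J\<close> is. Conversely, if the dimension is at least \<open>D\<close>, choose \<open>J\<close> with a nonzero coordinate. The translates of
  the Cramer vectors of \<open>J\<close> then span \<open>orbit_span L\<close>, so \<open>D\<close> of them are independent and have a nonzero
  minor.\<close>

lemma zariski_closed_dim_orbit_span_less:
  "zariski_closed_Gr r d {L :: ('n::finite, 'k::field) mpoly set. L \<in> Gr r d \<and> mp.dim (orbit_span L) < D}"
proof -
  obtain B :: "('n, 'k) mpoly set" where B: "finite B" "hom_comp d \<subseteq> mp.span B" by (rule hom_comp_finitely_spanned)
  define minors :: "('n mon list, 'k) mpoly set" where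
    "minors = {minor_form J rs cs | J rs cs. J \<in> plucker_index r d \<and> length rs = D \<and> length cs = D \<and>
       (\<forall>(\<sigma>, i) \<in> set rs. bij \<sigma> \<and> i < r) \<and> (\<forall>m\<in>set cs. mon_deg m = d)}"
  have form: "f \<in> form_in (plucker_index r d) D" if "f \<in> minors" for f
    using that by (auto simp: minors_def intro!: minor_form_in)
  have vanish_iff: "(\<forall>f\<in>minors. \<forall>vs. ordered_basis L vs \<longrightarrow> mp_eval (\<lambda>c. c) (plucker_coord vs) f = 0)
      \<longleftrightarrow> mp.dim (orbit_span L) < D" if L: "L \<in> Gr r d" for L :: "('n, 'k) mpoly set"
  proof (intro iffI ballI allI impI)
    fix f vs assume dim: "mp.dim (orbit_span L) < D" and f: "f \<in> minors" and vs: "ordered_basis L vs"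
    have len: "length vs = r" using L ordered_basis_length[OF vs] by (simp add: Gr_def)
    have Lvs: "L = mp.span (set vs)" using vs by (simp add: ordered_basis_def)
    obtain J rs cs where f_eq: "f = minor_form J rs cs" and J: "length J = r" and
      rs_len: "length rs = D" and rs_mem: "\<forall>(\<sigma>, i)\<in>set rs. bij \<sigma> \<and> i < r" and cs: "length cs = D"
      using f unfolding minors_def plucker_index_def by blast
    have rs: "length rs = D" "\<And>\<sigma> i. (\<sigma>, i) \<in> set rs \<Longrightarrow> bij \<sigma> \<and> i < r"
      using rs_len rs_mem by auto
    let ?ws = "map (\<lambda>(\<sigma>, i). perm_act \<sigma> (cramer_vector vs J i)) rs"
    have eval: "mp_eval (\<lambda>c. c) (plucker_coord vs) f = plucker_coord ?ws cs"
      unfolding f_eq by (rule mp_eval_minor_form) (use J rs cs len in auto)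
    show "mp_eval (\<lambda>c. c) (plucker_coord vs) f = 0"
    proof (rule ccontr)
      assume "mp_eval (\<lambda>c. c) (plucker_coord vs) f \<noteq> 0"
      then have ind: "distinct ?ws" "mp.independent (set ?ws)"
        using independent_of_plucker_coord[of ?ws cs] eval by simp_all
      have "w \<in> orbit_span L" if w: "w \<in> set ?ws" for w
      proof -
        obtain \<sigma> i where "(\<sigma>, i) \<in> set rs" "w = perm_act \<sigma> (cramer_vector vs J i)" using w by auto
        moreover have "cramer_vector vs J i \<in> L" unfolding Lvs by (rule cramer_vector_in_span)
        ultimately show ?thesis unfolding orbit_span_def using rs(2) by (intro mp.span_base) blast
      qed
      then have "set ?ws \<subseteq> orbit_span L" by blast
      moreover have "orbit_span L \<subseteq> mp.span B" using L B(2) orbit_span_hom_comp[of L d] by (auto simp: Gr_def)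
      ultimately have "card (set ?ws) \<le> mp.dim (orbit_span L)"
        using mp.independent_card_le_dim_finitely_spanned[OF _ ind(2) _ B(1)] by blast
      then show False using dim distinct_card[OF ind(1)] rs(1) by simp
    qed
  next
    assume van: "\<forall>f\<in>minors. \<forall>vs. ordered_basis L vs \<longrightarrow> mp_eval (\<lambda>c. c) (plucker_coord vs) f = 0"
    show "mp.dim (orbit_span L) < D"
    proof (rule ccontr)
      assume "\<not> ?thesis"
      then have dim: "D \<le> mp.dim (orbit_span L)" by simp
      obtain vs where vs: "ordered_basis L vs" using L by (rule Gr_ordered_basis)
      have len: "length vs = r" using L ordered_basis_length[OF vs] by (simp add: Gr_def)
      have Lvs: "L = mp.span (set vs)" and ind: "distinct vs" "mp.independent (set vs)"
        using vs by (auto simp: ordered_basis_def)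
      have Ld: "L \<subseteq> hom_comp d" using L by (simp add: Gr_def)
      have keys: "Poly_Mapping.keys v \<subseteq> {m. mon_deg m = d}" if "v \<in> hom_comp d" for v :: "('n, 'k) mpoly"
        using that by (auto simp: hom_comp_def)
      have "set vs \<subseteq> hom_comp d" using Ld Lvs mp.span_superset by blast
      then obtain J where J: "length J = r" "set J \<subseteq> {m. mon_deg m = d}" "plucker_coord vs J \<noteq> 0"
        using plucker_coord_nonzero_exists[OF ind, of "{m. mon_deg m = d}"] keys len by blast
      let ?S = "{perm_act \<sigma> g | \<sigma> g. bij \<sigma> \<and> g \<in> cramer_vector vs J ` {..<r}}"
      have "L = mp.span (cramer_vector vs J ` {..<r})"
        using span_cramer_vectors[of J vs] J len Lvs by simp
      then have "orbit_span L = orbit_span (cramer_vector vs J ` {..<r})"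
        by (simp only: orbit_span_span)
      then have "orbit_span L = mp.span ?S" by (simp only: orbit_span_def)
      moreover obtain C where C: "C \<subseteq> ?S" "mp.independent C" "?S \<subseteq> mp.span C" by (rule mp.maximal_independent_subset)
      ultimately have "orbit_span L = mp.span C"
        using C mp.span_mono[OF C(1)] mp.span_minimal[OF C(3) mp.subspace_span] by simp
      then have "D \<le> card C" using dim C(2) by (simp add: mp.dim_span_eq_card_independent del: mp.dim_span)
      then obtain C' where C': "C' \<subseteq> C" "card C' = D" "finite C'" by (rule obtain_subset_with_card_n)
      then obtain ws where ws: "set ws = C'" "distinct ws" using finite_distinct_list by blast
      have wsS: "set ws \<subseteq> ?S" using ws C' C by blast
      have lws: "length ws = D" using ws C'(2) distinct_card by fastforce
      have "\<forall>w\<in>set ws. \<exists>p. bij (fst p) \<and> snd p < r \<and> w = perm_act (fst p) (cramer_vector vs J (snd p))"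
        using wsS by fastforce
      then obtain row where row: "\<And>w. w \<in> set ws \<Longrightarrow> bij (fst (row w)) \<and> snd (row w) < r \<and>
          w = perm_act (fst (row w)) (cramer_vector vs J (snd (row w)))"
        by metis
      have "?S \<subseteq> hom_comp d"
        using cramer_vector_in_span[of vs J] Ld Lvs by (auto intro!: perm_act_hom_comp)
      then have "Poly_Mapping.keys w \<subseteq> {m. mon_deg m = d}" if "w \<in> set ws" for w
        using keys wsS that by blast
      moreover have "mp.independent (set ws)" using C(2) C'(1) ws(1) mp.independent_mono by blast
      ultimately obtain cs where cs: "length cs = D" "set cs \<subseteq> {m. mon_deg m = d}" "plucker_coord ws cs \<noteq> 0"
        using plucker_coord_nonzero_exists[OF ws(2), of "{m. mon_deg m = d}"] lws by blast
      let ?rs = "map row ws"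
      have rs: "bij \<sigma> \<and> i < r" if mem: "(\<sigma>, i) \<in> set ?rs" for \<sigma> i
      proof -
        obtain w where "w \<in> set ws" "(\<sigma>, i) = row w" using mem by auto
        then show ?thesis using row[of w] by (metis fst_conv snd_conv)
      qed
      have "map (\<lambda>(\<sigma>, i). perm_act \<sigma> (cramer_vector vs J i)) ?rs = ws"
        using row by (simp add: map_idI case_prod_beta)
      then have "mp_eval (\<lambda>c. c) (plucker_coord vs) (minor_form J ?rs cs) = plucker_coord ws cs"
        using mp_eval_minor_form[of J vs cs ?rs] rs J(1) len cs(1) lws by simp
      moreover have "minor_form J ?rs cs \<in> minors"
      proof -
        have "J \<in> plucker_index r d" using J by (auto simp: plucker_index_def)
        moreover have "length ?rs = D" using lws by simp
        moreover have "\<forall>(\<sigma>, i)\<in>set ?rs. bij \<sigma> \<and> i < r" using rs by blast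
        moreover have "\<forall>m\<in>set cs. mon_deg m = d" using cs(2) by auto
        ultimately show ?thesis
          unfolding minors_def using cs(1)
          by (intro CollectI exI[of _ J] exI[of _ ?rs] exI[of _ cs] conjI) simp_all
      qed
      ultimately show False using van vs cs(3) by auto
    qed
  qed
  show ?thesis
    unfolding zariski_closed_Gr_def id_def
  proof (intro exI[of _ minors] conjI)
    show "\<forall>f\<in>minors. (\<exists>e. f \<in> hom_comp e) \<and>
        (\<forall>m\<in>Poly_Mapping.keys f. Poly_Mapping.keys m \<subseteq> plucker_index r d)"
      using form unfolding form_in_def by blast
    show "{L. L \<in> Gr r d \<and> mp.dim (orbit_span L) < D} =
        {L \<in> Gr r d. \<forall>f\<in>minors. \<forall>vs. ordered_basis L vs \<longrightarrow>
            mp_eval (\<lambda>c. c) (plucker_coord vs) f = 0}"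
      by (rule Collect_cong, rule conj_cong[OF refl], rule vanish_iff[symmetric])
  qed
qed

section \<open>The general symmetric ideal\<close>

lemma Gr_superset:
  fixes S :: "('n::finite, 'k::field) mpoly set"
  assumes S: "finite S" "card S \<le> r" "S \<subseteq> hom_comp d"
    and r: "r \<le> mp.dim (hom_comp d :: ('n, 'k) mpoly set)"
  obtains L :: "('n, 'k) mpoly set" where "L \<in> Gr r d" "S \<subseteq> L"
proof -
  let ?V = "hom_comp d :: ('n, 'k) mpoly set"
  obtain F :: "('n, 'k) mpoly set" where F: "finite F" "?V \<subseteq> mp.span F" by (rule hom_comp_finitely_spanned)
  obtain A where A: "A \<subseteq> S" "mp.independent A" "S \<subseteq> mp.span A" by (rule mp.maximal_independent_subset)
  have finA: "finite A" "card A \<le> r" using A(1) S(1,2) card_mono[of S A] finite_subset by auto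
  have "A \<subseteq> ?V" using A(1) S(3) by blast
  then obtain B where B: "A \<subseteq> B" "B \<subseteq> ?V" "mp.independent B" "?V \<subseteq> mp.span B"
    by (rule mp.maximal_independent_subset_extend[OF _ A(2)])
  have "card B = mp.dim ?V" using B by (intro mp.basis_card_eq_dim)
  moreover have "finite B" using mp.independent_span_bound[OF F(1) B(3)] B(2) F(2) by blast
  ultimately obtain C where C: "A \<subseteq> C" "C \<subseteq> B" "card C = r"
    using exists_subset_between[of A r B] finA B(1) r by auto
  have "mp.independent C" using B(3) C(2) by (rule mp.independent_mono)
  then have "mp.dim (mp.span C) = r" using C(3) by (simp add: mp.dim_span_eq_card_independent del: mp.dim_span)
  moreover have "mp.span C \<subseteq> ?V" using C(2) B(2) by (intro mp.span_minimal subspace_hom_comp) blast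
  ultimately have "mp.span C \<in> Gr r d" by (simp add: Gr_def)
  moreover have "S \<subseteq> mp.span C" using A(3) mp.span_mono[OF C(1)] by blast
  ultimately show thesis by (rule that)
qed

lemma r_generated_orbit_span:
  assumes "L \<in> Gr r d"
  shows "r_generated r (orbit_span L)"
proof -
  obtain vs where vs: "ordered_basis L vs" using assms by (rule Gr_ordered_basis)
  have "length vs = r" using assms ordered_basis_length[OF vs] by (simp add: Gr_def)
  moreover have "orbit_span L = orbit_span (set vs)" using vs orbit_span_span[of "set vs"] by (simp add: ordered_basis_def)
  ultimately show ?thesis
    unfolding r_generated_def hull_eq_orbit_span using card_length[of vs] by blast
qed

theorem proposition5p2:
  fixes r d :: nat
  assumes "infinite (UNIV :: 'k::field set)"
    and "CHAR('k) = 0 \<or> CHAR('k) > CARD('n::finite)"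
    and "1 \<le> r"
    and "r \<le> mp.dim (hom_comp d :: ('n, 'k) mpoly set)"
  shows "general_sym_ideal r d (\<lambda>I :: ('n, 'k) mpoly set.
           (\<forall>M :: ('n, 'k) mpoly set. maximal_r_generated r d M \<longrightarrow>
                 mp.dim (I \<inter> hom_comp d) = mp.dim M) \<and>
           maximal_r_generated r d (I \<inter> hom_comp d))"
proof -
  let ?V = "hom_comp d :: ('n, 'k) mpoly set"
  obtain F :: "('n, 'k) mpoly set" where F: "finite F" "?V \<subseteq> mp.span F" by (rule hom_comp_finitely_spanned)
  define dims where "dims = {mp.dim N | N :: ('n, 'k) mpoly set. N \<subseteq> ?V \<and> r_generated r N}"
  have "dims \<subseteq> {..mp.dim ?V}"
    using mp.dim_mono_finitely_spanned[OF _ F(2,1)] by (auto simp: dims_def)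
  then have fin: "finite dims" by (rule finite_subset) simp
  have "orbit_span {} \<subseteq> ?V" by (rule orbit_span_hom_comp) simp
  moreover have "r_generated r (orbit_span {} :: ('n, 'k) mpoly set)"
    unfolding r_generated_def hull_eq_orbit_span by (intro exI[of _ "{}"]) simp
  ultimately have ne: "dims \<noteq> {}" unfolding dims_def by blast
  define D where "D = Max dims"
  have le_D: "mp.dim N \<le> D" if "N \<subseteq> ?V" "r_generated r N" for N
    unfolding D_def by (rule Max_ge[OF fin]) (use that in \<open>auto simp: dims_def\<close>)
  define U where "U = {L :: ('n, 'k) mpoly set. L \<in> Gr r d \<and> mp.dim (orbit_span L) = D}"
  have Gr_sub: "orbit_span L \<subseteq> ?V" if "L \<in> Gr r d" for L
    using that by (intro orbit_span_hom_comp) (simp add: Gr_def)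
  have "Gr r d - U = {L. L \<in> Gr r d \<and> mp.dim (orbit_span L) < D}"
    using le_D[OF Gr_sub r_generated_orbit_span] by (force simp: U_def)
  then have "zariski_open_Gr r d U"
    using zariski_closed_dim_orbit_span_less[of r d D] by (auto simp: zariski_open_Gr_def U_def)
  moreover have "U \<noteq> {}"
  proof -
    have "D \<in> dims" unfolding D_def using fin ne by (rule Max_in)
    then obtain S :: "('n, 'k) mpoly set" where S: "finite S" "card S \<le> r" "orbit_span S \<subseteq> ?V" "mp.dim (orbit_span S) = D"
      by (auto simp: dims_def r_generated_def hull_eq_orbit_span)
    have "S \<subseteq> ?V" using S(3) orbit_span_superset by blast
    then obtain L where L: "L \<in> Gr r d" "S \<subseteq> L" using Gr_superset[OF S(1,2) _ assms(4)] by blast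
    have "D \<le> mp.dim (orbit_span L)"
      using mp.dim_mono_finitely_spanned[OF orbit_span_mono[OF L(2)] _ F(1)] Gr_sub[OF L(1)] F(2) S(4) by auto
    then have "L \<in> U" using le_D[OF Gr_sub r_generated_orbit_span, OF L(1) L(1)] L(1) by (simp add: U_def)
    then show ?thesis by blast
  qed
  moreover have "(\<forall>M :: ('n, 'k) mpoly set. maximal_r_generated r d M \<longrightarrow>
        mp.dim (sym_ideal L \<inter> ?V) = mp.dim M) \<and> maximal_r_generated r d (sym_ideal L \<inter> ?V)"
    if "L \<in> U" for L
  proof -
    have L: "L \<in> Gr r d" "mp.dim (orbit_span L) = D" using that by (auto simp: U_def)
    have I: "sym_ideal L \<inter> ?V = orbit_span L" using L(1) by (intro sym_ideal_Int_hom_comp) (simp add: Gr_def)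
    have gen: "r_generated r (orbit_span L)" and sub: "orbit_span L \<subseteq> ?V"
      using L(1) by (rule r_generated_orbit_span, intro Gr_sub)
    have "N = orbit_span L" if N: "N \<subseteq> ?V" "r_generated r N" "orbit_span L \<subseteq> N"
      for N :: "('n, 'k) mpoly set"
      using mp.subspace_eq_finitely_spanned[OF subspace_orbit_span N(3) _ _ F(1)] le_D[OF N(1,2)] L(2) N(1) F(2) by auto
    then have "maximal_r_generated r d (orbit_span L)"
      unfolding maximal_r_generated_def using gen sub by blast
    moreover have "mp.dim (orbit_span L) = mp.dim M" if M: "maximal_r_generated r d M"
      for M :: "('n, 'k) mpoly set"
    proof (rule antisym)
      show "mp.dim (orbit_span L) \<le> mp.dim M"
        by (rule dim_le_of_maximal_r_generated[OF assms(2) M gen sub])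
      show "mp.dim M \<le> mp.dim (orbit_span L)" 
        using le_D M L(2) by (auto simp: maximal_r_generated_def)
    qed
    ultimately show ?thesis by (simp add: I)
  qed
  ultimately show ?thesis unfolding general_sym_ideal_def by blast
qed

end
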